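(* Let $p$ be a monic polynomial of degree $d\ge2$ and let $a\in\mathbb D_R$. If $c$ is an order one critical point of $p$, then the (extended) critical locus $\mathscr C_a$ passes through the point $(u,y)=(0,c)$, where $u=1/x$, and is smooth at this point. Moreover, the restriction $\varphi_{a,+}^{-1}|_{\mathscr C_a}\to\mathbb C$ is a local biholomorphism about this point.
   Context: $\mathbb D_\rho=\{|z|<\rho\}$. Let $p(x)=x^d+q(x)$ with $d\ge2$, $\deg q<d$, and for $a\in\mathbb C$ let $f_a(x,y)=(p(x)-ay,x)$ on $\mathbb C^2$. Fix $R>0$, $0<r<1$ and $\alpha>0$ such that $|q(y)/y^d|+(R+1)/|y|^{d-1}<r$ and $|p(y)|>(2R+1)|y|$ whenever $|y|\ge\alpha$. Put $V_+=\{|x|>|y|,\ |x|>\alpha\}$, $V_-=\{|y|>|x|,\ |y|>\alpha\}$; for $a\in\mathbb D_R$ one has $f_a(V_+)\subset V_+$, and $f_a^{-1}(V_-)\subset V_-$ if $a\neq0$. Write $(x_n,y_n)=f_a^{n}(x,y)$. For $a\in\mathbb D_R$ (principal logarithms): $\varphi_{a,+}(x,y)=x\exp\big(\sum_{k\ge1}d^{-k}\log(x_k/x_{k-1}^d)\big)$ on $V_+$, and $\varphi_{a,-}(x,y)=y\exp\big(\sum_{k\ge1}d^{-k}\log(a\,y_{-k}/y_{-(k-1)}^d)\big)$ on $V_-$, where each $a\,y_{-k}/y_{-(k-1)}^d$ extends holomorphically to $a=0$. They are holomorphic in $(x,y,a)$, with $\varphi_{a,+}\circ f_a=\varphi_{a,+}^d$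 and $a\,\varphi_{a,-}\circ f_a^{-1}=\varphi_{a,-}^d$ ($a\ne0$). Work in $\mathbb P^1\times\mathbb P^1$ with coordinates $(u,y)$, $u=1/x$, near the line $u=0$ ($y$ finite). The function $\varphi_{a,+}^{-1}$ extends holomorphically in $(u,y,a)$ across $\{u=0\}$, vanishing there. The function $\varphi_{a,-}^{-d}$, defined by $\varphi_{a,-}^{-d}=1/(a\,\varphi_{a,-}\circ f_a^{-1})$ for $a\ne0$ and $(x,y)\in f_a(V_-)$, and by $\varphi_{0,-}^{-d}=1/(p(y)-x)$ for $a=0$, $x\neq p(y)$, also extends holomorphically in $(u,y,a)$ across $\{u=0\}$, vanishing there. One has $d\varphi_{+}^{-1}\wedge d\varphi_{-}^{-d}\wedge da=u^2\,\tilde w(u,y,a)\,du\wedge dy\wedge da$ with $\tilde w$ holomorphic. In the finite part ($u\ne0$), the zero variety of $\tilde w(\cdot,\cdot,a)$ (with multiplicity) is the critical locus $\mathscr C_a$, i.e. the tangency locus of the foliations whose leaves are locally the level sets of $\varphi_{a,+}$ and of $\varphi_{a,-}$ respectively; the extended critical locus near $u=0$, still denoted $\mathscr C_a$, is by definition the zero variety of $\tilde w(\cdot,\cdot,a)$ (so the spurious double component $u=0$ is discarded). *)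

theory Defs
  imports "HOL-Complex_Analysis.Complex_Analysis" "HOL-Computational_Algebra.Polynomial"
begin

section \<open>The maps and the regions\<close>

definition henon :: "complex poly \<Rightarrow> complex \<Rightarrow> complex \<times> complex \<Rightarrow> complex \<times> complex" where
  "henon p a = (\<lambda>(x, y). (poly p x - a * y, x))"

definition henon_inv :: "complex poly \<Rightarrow> complex \<Rightarrow> complex \<times> complex \<Rightarrow> complex \<times> complex" where
  "henon_inv p a = (\<lambda>(x, y). (y, (poly p y - x) / a))"

lemma henon_inverse:
  assumes "a \<noteq> 0"
  shows "henon_inv p a (henon p a z) = z" and "henon p a (henon_inv p a z) = z"
  using assms by (auto simp: henon_def henon_inv_def split: prod.splits)

definition V_plus :: "real \<Rightarrow> (complex \<times> complex) set" where
  "V_plus \<alpha> = {(x, y). norm x > norm y \<and> norm x > \<alpha>}"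

definition V_minus :: "real \<Rightarrow> (complex \<times> complex) set" where
  "V_minus \<alpha> = {(x, y). norm y > norm x \<and> norm y > \<alpha>}"

section \<open>Boettcher-type functions\<close>

definition fwd_ratio :: "complex poly \<Rightarrow> complex \<Rightarrow> complex \<times> complex \<Rightarrow> nat \<Rightarrow> complex" where
  "fwd_ratio p a z k =
     fst ((henon p a ^^ k) z) / fst ((henon p a ^^ (k - 1)) z) ^ degree p"

text \<open>The series over \<open>k \<ge> 1\<close> are indexed from 0, with \<open>Suc k\<close> in place of \<open>k\<close>.\<close>

definition phi_plus :: "complex poly \<Rightarrow> complex \<Rightarrow> complex \<times> complex \<Rightarrow> complex" where
  "phi_plus p a z =
     fst z * exp (\<Sum>k. Ln (fwd_ratio p a z (Suc k)) / of_nat (degree p) ^ Suc k)"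

definition bwd_ratio :: "complex poly \<Rightarrow> complex \<Rightarrow> complex \<times> complex \<Rightarrow> nat \<Rightarrow> complex" where
  "bwd_ratio p a z k =
     a * snd ((henon_inv p a ^^ k) z) / snd ((henon_inv p a ^^ (k - 1)) z) ^ degree p"

text \<open>The value at \<open>a = 0\<close> is the one given by holomorphic extension in \<open>a\<close>.\<close>

definition bwd_ratio_ext :: "complex poly \<Rightarrow> complex \<Rightarrow> complex \<times> complex \<Rightarrow> nat \<Rightarrow> complex" where
  "bwd_ratio_ext p a z k =
     (if a = 0 then Lim (at 0) (\<lambda>b. bwd_ratio p b z k) else bwd_ratio p a z k)"

definition phi_minus :: "complex poly \<Rightarrow> complex \<Rightarrow> complex \<times> complex \<Rightarrow> complex" where
  "phi_minus p a z =
     snd z * exp (\<Sum>k. Ln (bwd_ratio_ext p a z (Suc k)) / of_nat (degree p) ^ Suc k)"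

section \<open>Extension across the line at infinity, in the coordinates \<open>(u, y)\<close> with \<open>u = 1/x\<close>\<close>

text \<open>The values at \<open>u = 0\<close> are those of the holomorphic extensions.\<close>

definition phi_plus_inv :: "complex poly \<Rightarrow> complex \<Rightarrow> complex \<times> complex \<Rightarrow> complex" where
  "phi_plus_inv p a = (\<lambda>(u, y). if u = 0 then 0 else 1 / phi_plus p a (1 / u, y))"

definition phi_minus_inv_d :: "complex poly \<Rightarrow> complex \<Rightarrow> complex \<times> complex \<Rightarrow> complex" where
  "phi_minus_inv_d p a = (\<lambda>(u, y).
     if u = 0 then 0
     else if a = 0 then 1 / (poly p y - 1 / u)
     else 1 / (a * phi_minus p a (henon_inv p a (1 / u, y))))"

text \<open>The points \<open>(u, y)\<close> at which both extended functions are defined.\<close>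

definition ext_domain :: "complex poly \<Rightarrow> real \<Rightarrow> complex \<Rightarrow> (complex \<times> complex) set" where
  "ext_domain p \<alpha> a = {(u, y).
     u = 0 \<or>
     (1 / u, y) \<in> V_plus \<alpha> \<and>
       (if a = 0 then 1 / u \<noteq> poly p y else (1 / u, y) \<in> henon p a ` V_minus \<alpha>)}"

text \<open>Because of the factor \<open>da\<close>, the coefficient of the 3-form
  \<open>d phi_plus_inv \<and> d phi_minus_inv_d \<and> da\<close> with respect to \<open>du \<and> dy \<and> da\<close> is the
  Jacobian determinant in \<open>(u, y)\<close> at fixed \<open>a\<close>.\<close>

definition form_coeff :: "complex poly \<Rightarrow> complex \<Rightarrow> complex \<times> complex \<Rightarrow> complex" where
  "form_coeff p a = (\<lambda>(u, y).
     deriv (\<lambda>v. phi_plus_inv p a (v, y)) u * deriv (\<lambda>t. phi_minus_inv_d p a (u, t)) y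
   - deriv (\<lambda>t. phi_plus_inv p a (u, t)) y * deriv (\<lambda>v. phi_minus_inv_d p a (v, y)) u)"

text \<open>The holomorphic function with \<open>form_coeff = u\<^sup>2 * w_tilde\<close>; on \<open>u = 0\<close>, where the
  quotient is undefined, its value is the limit as \<open>u\<close> tends to 0.\<close>

definition w_tilde :: "complex poly \<Rightarrow> complex \<Rightarrow> complex \<times> complex \<Rightarrow> complex" where
  "w_tilde p a = (\<lambda>(u, y).
     if u = 0 then Lim (at 0) (\<lambda>v. form_coeff p a (v, y) / v ^ 2)
     else form_coeff p a (u, y) / u ^ 2)"

section \<open>Holomorphic functions of two variables and zero varieties\<close>

text \<open>Complex differentiability in two variables, meant for open sets \<open>S\<close>.\<close>

definition holomorphic2_on :: "(complex \<times> complex \<Rightarrow> complex) \<Rightarrow> (complex \<times> complex) set \<Rightarrow> bool"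
  where "holomorphic2_on F S \<longleftrightarrow>
     (\<forall>z\<in>S. \<exists>A B. (F has_derivative (\<lambda>(h, k). A * h + B * k)) (at z))"

definition biholomorphism2 ::
  "(complex \<times> complex) set \<Rightarrow> (complex \<times> complex) set \<Rightarrow>
   (complex \<times> complex \<Rightarrow> complex \<times> complex) \<Rightarrow> (complex \<times> complex \<Rightarrow> complex \<times> complex) \<Rightarrow> bool"
  where "biholomorphism2 U V \<psi> \<psi>' \<longleftrightarrow>
     open U \<and> open V \<and> homeomorphism U V \<psi> \<psi>' \<and>
     holomorphic2_on (fst \<circ> \<psi>) U \<and> holomorphic2_on (snd \<circ> \<psi>) U \<and>
     holomorphic2_on (fst \<circ> \<psi>') V \<and> holomorphic2_on (snd \<circ> \<psi>') V"

definition zero_variety ::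
  "(complex \<times> complex) set \<Rightarrow> (complex \<times> complex \<Rightarrow> complex) \<Rightarrow> (complex \<times> complex) set" where
  "zero_variety S g = {z \<in> S. g z = 0}"

text \<open>Smoothness at \<open>z\<close> of the zero variety of \<open>g\<close> in \<open>S\<close>, counted with multiplicity: in suitable
  local holomorphic coordinates \<open>\<psi>\<close> around \<open>z\<close> the function \<open>g\<close> is the first coordinate times a
  holomorphic unit, so that the zero variety is a coordinate line with multiplicity one.\<close>

definition smooth_zero_variety_at ::
  "(complex \<times> complex) set \<Rightarrow> (complex \<times> complex \<Rightarrow> complex) \<Rightarrow> complex \<times> complex \<Rightarrow> bool" where
  "smooth_zero_variety_at S g z \<longleftrightarrow>
     z \<in> zero_variety S g \<and>
     (\<exists>U V \<psi> \<psi>' h. z \<in> U \<and> U \<subseteq> S \<and> biholomorphism2 U V \<psi> \<psi>' \<and>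
        holomorphic2_on h U \<and> (\<forall>t\<in>U. h t \<noteq> 0 \<and> g t = fst (\<psi> t) * h t))"

text \<open>A map into a curve in \<open>\<complex>\<^sup>2\<close> that is smooth at the point in question is holomorphic iff its two
  components are; the restriction of \<open>F\<close> to the curve is holomorphic since \<open>F\<close> itself is.\<close>

definition restr_local_biholomorphism_at ::
  "(complex \<times> complex \<Rightarrow> complex) \<Rightarrow> (complex \<times> complex) set \<Rightarrow> complex \<times> complex \<Rightarrow> bool" where
  "restr_local_biholomorphism_at F C z \<longleftrightarrow>
     z \<in> C \<and>
     (\<exists>U W G. open U \<and> z \<in> U \<and> open W \<and> holomorphic2_on F U \<and>
        homeomorphism (C \<inter> U) W F G \<and>
        (fst \<circ> G) holomorphic_on W \<and> (snd \<circ> G) holomorphic_on W)"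

definition critical_locus :: "complex poly \<Rightarrow> real \<Rightarrow> complex \<Rightarrow> (complex \<times> complex) set" where
  "critical_locus p \<alpha> a = zero_variety (ext_domain p \<alpha> a) (w_tilde p a)"

end

theory Submission
  imports Defs
begin

text \<open>
Everything reduces to the behaviour of the two extended functions to second order in \<open>u\<close>. Near the
line \<open>u = 0\<close> one has
\<open>\<phi>\<^sub>+\<^sup>-\<^sup>1 = u + u\<^sup>2 E(u, y)\<close> and \<open>\<phi>\<^sub>-\<^sup>-\<^sup>d = - u + u\<^sup>2 N(u, y)\<close> with \<open>E\<close> and \<open>N\<close> holomorphic. The
Jacobian determinant of such a pair is \<open>u\<^sup>2\<close> times a holomorphic function whose restriction to
\<open>u = 0\<close> is the \<open>y\<close>-derivative of \<open>E(0, y) + N(0, y)\<close> (\<open>jacobian_factors\<close>). Here \<open>E(0, y)\<close> is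
constant and \<open>N(0, y) = const - p(y)\<close> (\<open>extended_functions_expansion\<close>), so \<open>w_tilde\<close> restricts to
\<open>- p'(y)\<close>. If \<open>c\<close> is a simple zero of \<open>p'\<close>, then \<open>w_tilde\<close> vanishes at \<open>(0, c)\<close> and has nonzero
\<open>y\<close>-derivative there, whereas \<open>\<phi>\<^sub>+\<^sup>-\<^sup>1\<close> has \<open>u\<close>-derivative \<open>1\<close> and \<open>y\<close>-derivative \<open>0\<close>. Hence
\<open>(w_tilde, \<phi>\<^sub>+\<^sup>-\<^sup>1)\<close> are local holomorphic coordinates at \<open>(0, c)\<close>, which contains both assertions at
once (\<open>restriction_coordinates\<close>).

The expansions come from writing the dynamics in the coordinates \<open>u = 1/x\<close>, \<open>t = y/x\<close>, in which
forward iteration on \<open>V\<^sub>+\<close> and, after interchanging the coordinates, backward iteration on \<open>V\<^sub>-\<close> are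
two instances of one map that is holomorphic across \<open>u = 0\<close>. There both functions are given by the
same infinite product of ratios. It is holomorphic and equal to \<open>1\<close> on \<open>u = 0\<close>, so it has the form
\<open>1 + u g(u, t)\<close> (\<open>inf_factor_expansion\<close>). For \<open>\<phi>\<^sub>+\<close> one substitutes \<open>t = u y\<close>. For \<open>\<phi>\<^sub>-\<close> one
substitutes the reciprocal \<open>v = a u / (u p(y) - 1)\<close> of the second coordinate of the preimage, and
\<open>p\<close> enters through the prefactor \<open>u / (u p(y) - 1)\<close>.

The tools from several complex variables are Osgood's lemma, holomorphy of partial derivatives and
of uniform limits, divisibility by \<open>u\<close> and the inverse function theorem; they are derived from
Cauchy's theory in one variable.
\<close>

section \<open>Osgood's lemma and partial derivatives\<close>

text \<open>This notion is the bridge between one and two variables: its slices are accessible to Cauchy's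
theory, and on open sets it coincides with complex differentiability in two variables, by Osgood's
lemma (\<open>holomorphic2_on_iff_separately\<close> below).\<close>

definition sep_holomorphic_on :: "(complex \<times> complex \<Rightarrow> complex) \<Rightarrow> (complex \<times> complex) set \<Rightarrow> bool"
  where "sep_holomorphic_on F S \<longleftrightarrow> continuous_on S F \<and>
     (\<forall>u y. (u, y) \<in> S \<longrightarrow> (\<lambda>v. F (v, y)) field_differentiable at u \<and>
                         (\<lambda>t. F (u, t)) field_differentiable at y)"

lemma open_contains_polydisc:
  assumes "open (S :: (complex \<times> complex) set)" "(u, y) \<in> S"
  obtains r where "r > 0" "cball u r \<times> cball y r \<subseteq> S"
proof -
  obtain e where e: "e > 0" "cball (u, y) e \<subseteq> S"
    using assms open_contains_cball by metis
  have "cball u (e/2) \<times> cball y (e/2) \<subseteq> cball (u, y) e"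
  proof safe
    fix a b assume "a \<in> cball u (e/2)" "b \<in> cball y (e/2)"
    moreover have "dist (u, y) (a, b) \<le> dist u a + dist y b"
      unfolding dist_prod_def fst_conv snd_conv
      by (rule sqrt_sum_squares_le_sum) auto
    ultimately show "(a, b) \<in> cball (u, y) e" by simp
  qed
  with e that[of "e/2"] show ?thesis by auto
qed

lemma sep_holomorphic_slice:
  assumes "sep_holomorphic_on F S" "A \<times> {y} \<subseteq> S"
  shows "(\<lambda>v. F (v, y)) holomorphic_on A"
  using assms unfolding sep_holomorphic_on_def holomorphic_on_def
  by (blast intro: field_differentiable_at_within)

lemma sep_holomorphic_slice_snd:
  assumes "sep_holomorphic_on F S" "{u} \<times> A \<subseteq> S"
  shows "(\<lambda>t. F (u, t)) holomorphic_on A"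
  using assms unfolding sep_holomorphic_on_def holomorphic_on_def
  by (blast intro: field_differentiable_at_within)

text \<open>Cauchy's inequality, applied to the difference of two slices of \<open>F\<close>, turns the uniform continuity of
\<open>F\<close> on a compact polydisc into equicontinuity of the partial derivative in the other variable. With
the continuity of a single slice of the derivative this gives joint continuity.\<close>

lemma continuous_partial_fst:
  assumes S: "open S" and F: "sep_holomorphic_on F S"
  shows "continuous_on S (\<lambda>z. deriv (\<lambda>v. F (v, snd z)) (fst z))"
proof -
  have "isCont (\<lambda>z. deriv (\<lambda>v. F (v, snd z)) (fst z)) (u0, y0)" if z: "(u0, y0) \<in> S" for u0 y0
  proof -
    let ?D = "\<lambda>u y. deriv (\<lambda>v. F (v, y)) u"
    obtain \<rho>0 where \<rho>0: "\<rho>0 > 0" "cball u0 \<rho>0 \<times> cball y0 \<rho>0 \<subseteq> S"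
      using open_contains_polydisc[OF S z] .
    \<comment> \<open>Half the radius, so that the circles of radius \<open>\<rho>\<close> about nearby points stay in \<open>?K\<close>.\<close>
    define \<rho> where "\<rho> = \<rho>0 / 2"
    have \<rho>: "\<rho> > 0" "\<rho>0 = 2 * \<rho>" using \<rho>0 by (auto simp: \<rho>_def)
    let ?K = "cball u0 \<rho>0 \<times> cball y0 \<rho>0"
    have "uniformly_continuous_on ?K F"
      by (rule compact_uniformly_continuous)
        (use F \<rho>0 in \<open>auto simp: sep_holomorphic_on_def intro: continuous_on_subset compact_Times\<close>)
    note uc = this[unfolded uniformly_continuous_on_def, rule_format]
    have hol: "(\<lambda>v. F (v, y)) holomorphic_on cball u0 \<rho>0" if "y \<in> cball y0 \<rho>0" for y
      by (rule sep_holomorphic_slice[OF F]) (use \<rho>0 that in auto)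
    have close: "norm (?D u y - ?D u y0) \<le> e"
      if e: "e > 0" and \<delta>: "\<And>x x'. x \<in> ?K \<Longrightarrow> x' \<in> ?K \<Longrightarrow> dist x' x < \<delta> \<Longrightarrow> dist (F x') (F x) < e * \<rho>"
        and u: "u \<in> ball u0 \<rho>" and y: "y \<in> ball y0 (min \<delta> \<rho>)" for e \<delta> u y
    proof -
      have sub: "cball u \<rho> \<subseteq> cball u0 \<rho>0"
      proof
        fix x assume "x \<in> cball u \<rho>"
        then show "x \<in> cball u0 \<rho>0"
          using u \<rho> dist_triangle[of u0 x u] by simp
      qed
      have yK: "y \<in> cball y0 \<rho>0" "y0 \<in> cball y0 \<rho>0" using y \<rho> by (auto simp: dist_commute)
      have h1: "(\<lambda>v. F (v, y)) holomorphic_on cball u \<rho>" "(\<lambda>v. F (v, y0)) holomorphic_on cball u \<rho>"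
        using hol yK sub holomorphic_on_subset by blast+
      have "u \<in> ball u \<rho>" using \<rho> by simp
      then have fd: "(\<lambda>v. F (v, y)) field_differentiable at u" "(\<lambda>v. F (v, y0)) field_differentiable at u"
        using h1 by (meson ball_subset_cball holomorphic_on_imp_differentiable_at holomorphic_on_subset open_ball)+
      have "norm ((deriv ^^ 1) (\<lambda>v. F (v, y) - F (v, y0)) u) \<le> fact 1 * (e * \<rho>) / \<rho> ^ 1"
      proof (rule Cauchy_inequality)
        show "(\<lambda>v. F (v, y) - F (v, y0)) holomorphic_on ball u \<rho>"
          using h1 by (intro holomorphic_intros) (auto intro: holomorphic_on_subset)
        show "continuous_on (cball u \<rho>) (\<lambda>v. F (v, y) - F (v, y0))"
          using h1 by (intro continuous_intros holomorphic_on_imp_continuous_on)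
        fix x assume "norm (u - x) = \<rho>"
        then have "x \<in> cball u \<rho>" by (simp add: dist_norm)
        with sub have "x \<in> cball u0 \<rho>0" by blast
        moreover have "dist (x, y) (x, y0) < \<delta>" using y by (simp add: dist_Pair_Pair dist_commute)
        ultimately have "dist (F (x, y)) (F (x, y0)) < e * \<rho>"
          using yK by (intro \<delta>) auto
        then show "norm (F (x, y) - F (x, y0)) \<le> e * \<rho>" by (simp add: dist_norm)
      qed (use \<rho> in auto)
      then show ?thesis using fd \<rho> by (simp add: deriv_diff)
    qed
    have c0: "isCont (\<lambda>u. ?D u y0) u0"
    proof -
      have "(\<lambda>v. F (v, y0)) holomorphic_on ball u0 \<rho>0"
        using hol[of y0] \<rho>0 by (auto intro: holomorphic_on_subset)
      then have "?D u0 y0 = ?D u0 y0 \<and> (\<lambda>u. ?D u y0) holomorphic_on ball u0 \<rho>0"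
        by (auto intro: holomorphic_deriv)
      then show ?thesis
        using \<rho>0 by (auto intro!: continuous_on_interior[of "ball u0 \<rho>0"] holomorphic_on_imp_continuous_on)
    qed
    show ?thesis
      unfolding continuous_at_eps_delta
    proof safe
      fix e :: real assume e: "e > 0"
      obtain \<delta> where \<delta>: "\<delta> > 0" "\<And>x x'. x \<in> ?K \<Longrightarrow> x' \<in> ?K \<Longrightarrow> dist x' x < \<delta> \<Longrightarrow> dist (F x') (F x) < (e/2) * \<rho>"
        using uc[of "e/2 * \<rho>"] e \<rho> by auto
      obtain \<eta> where \<eta>: "\<eta> > 0" "\<And>u. dist u u0 < \<eta> \<Longrightarrow> dist (?D u y0) (?D u0 y0) < e/2"
        using c0[unfolded continuous_at_eps_delta] e by (metis half_gt_zero)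
      have "dist (?D (fst x) (snd x)) (?D u0 y0) < e" if "dist x (u0, y0) < min \<eta> (min \<delta> \<rho>)" for x
      proof -
        have x: "dist (fst x) u0 < min \<eta> (min \<delta> \<rho>)" "dist (snd x) y0 < min \<eta> (min \<delta> \<rho>)"
          using that dist_fst_le[of x "(u0,y0)"] dist_snd_le[of x "(u0,y0)"] by auto
        have "norm (?D (fst x) (snd x) - ?D (fst x) y0) \<le> e/2"
          by (rule close[OF _ \<delta>(2)]) (use e x in \<open>auto simp: dist_commute\<close>)
        with \<eta>(2)[of "fst x"] x show ?thesis
          unfolding dist_norm using norm_triangle_ineq[of "?D (fst x) (snd x) - ?D (fst x) y0" "?D (fst x) y0 - ?D u0 y0"]
          by simp
      qed
      then show "\<exists>d>0. \<forall>x. dist x (u0, y0) < d \<longrightarrow>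
          dist (?D (fst x) (snd x)) (?D (fst (u0, y0)) (snd (u0, y0))) < e"
        using \<eta> \<delta> \<rho> by (intro exI[of _ "min \<eta> (min \<delta> \<rho>)"]) auto
    qed
  qed
  then show ?thesis by (auto intro!: continuous_at_imp_continuous_on)
qed

lemma sep_holomorphic_swap:
  assumes "sep_holomorphic_on F S"
  shows "sep_holomorphic_on (F \<circ> prod.swap) (prod.swap ` S)"
  unfolding sep_holomorphic_on_def
proof (intro conjI allI impI)
  show "continuous_on (prod.swap ` S) (F \<circ> prod.swap)"
    using assms unfolding sep_holomorphic_on_def
    by (intro continuous_on_compose continuous_on_swap) (auto simp: image_image)
qed (use assms in \<open>auto simp: sep_holomorphic_on_def\<close>)

lemma open_swap_image: "open S \<Longrightarrow> open (prod.swap ` (S :: (complex \<times> complex) set))"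
proof -
  have "prod.swap ` S = prod.swap -` S" by force
  moreover assume "open S"
  ultimately show ?thesis
    using continuous_on_swap[of UNIV] by (metis continuous_on_open_vimage inf_top.right_neutral open_UNIV)
qed

lemma continuous_partial_snd:
  assumes S: "open S" and F: "sep_holomorphic_on F S"
  shows "continuous_on S (\<lambda>z. deriv (\<lambda>t. F (fst z, t)) (snd z))"
proof -
  have "continuous_on (prod.swap ` S) (\<lambda>z. deriv (\<lambda>v. F (snd z, v)) (fst z))"
    using continuous_partial_fst[OF open_swap_image[OF S] sep_holomorphic_swap[OF F]] by simp
  from continuous_on_compose[OF continuous_on_swap this] show ?thesis by (simp add: o_def)
qed

text \<open>The difference quotients in \<open>u\<close> are holomorphic in \<open>y\<close>. By the mean value inequality and the uniform
continuity of the partial derivative they converge to it uniformly in \<open>y\<close>, so the limit is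
holomorphic in \<open>y\<close> as well.\<close>

lemma sep_holomorphic_partial_fst:
  assumes S: "open S" and F: "sep_holomorphic_on F S"
  shows "sep_holomorphic_on (\<lambda>(u, y). deriv (\<lambda>v. F (v, y)) u) S"
proof -
  let ?D = "\<lambda>u y. deriv (\<lambda>v. F (v, y)) u"
  have cont: "continuous_on S (\<lambda>(u, y). ?D u y)"
    using continuous_partial_fst[OF S F] by (simp add: case_prod_beta)
  have "(\<lambda>v. ?D v y0) field_differentiable at u0 \<and> ?D u0 field_differentiable at y0"
    if z: "(u0, y0) \<in> S" for u0 y0
  proof
    obtain \<rho> where \<rho>: "\<rho> > 0" "cball u0 \<rho> \<times> cball y0 \<rho> \<subseteq> S"
      using open_contains_polydisc[OF S z] .
    let ?K = "cball u0 \<rho> \<times> cball y0 \<rho>"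
    have hol: "(\<lambda>v. F (v, y)) holomorphic_on cball u0 \<rho>" if "y \<in> cball y0 \<rho>" for y
      by (rule sep_holomorphic_slice[OF F]) (use \<rho> that in auto)
    then have holb: "(\<lambda>v. F (v, y)) holomorphic_on ball u0 \<rho>" if "y \<in> cball y0 \<rho>" for y
      using that by (meson ball_subset_cball holomorphic_on_subset)
    have "(\<lambda>v. ?D v y0) holomorphic_on ball u0 \<rho>"
      using \<rho> by (intro holomorphic_deriv holb) auto
    then show "(\<lambda>v. ?D v y0) field_differentiable at u0"
      using \<rho> by (intro holomorphic_on_imp_differentiable_at) auto
    let ?q = "\<lambda>h y. (F (u0 + h, y) - F (u0, y)) / h"
    have "uniform_limit (cball y0 \<rho>) ?q (?D u0) (at 0)"
      unfolding uniform_limit_iff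
    proof (intro allI impI)
      fix e :: real assume e: "e > 0"
      have "uniformly_continuous_on ?K (\<lambda>(u, y). ?D u y)"
        by (rule compact_uniformly_continuous)
          (use cont \<rho> in \<open>auto intro: continuous_on_subset compact_Times\<close>)
      then obtain \<delta> where \<delta>: "\<delta> > 0"
        "\<And>x x'. x \<in> ?K \<Longrightarrow> x' \<in> ?K \<Longrightarrow> dist x' x < \<delta> \<Longrightarrow>
          dist ((\<lambda>(u, y). ?D u y) x') ((\<lambda>(u, y). ?D u y) x) < e/2"
        unfolding uniformly_continuous_on_def using half_gt_zero[OF e] by blast
      have "dist (?q h y) (?D u0 y) < e"
        if h: "dist h 0 < min \<delta> \<rho>" "h \<noteq> 0" and y: "y \<in> cball y0 \<rho>" for h y
      proof -
        let ?f = "\<lambda>v. F (v, y) - v * ?D u0 y"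
        have "norm (?f (u0 + h) - ?f u0) \<le> e/2 * norm (u0 + h - u0)"
        proof (rule field_differentiable_bound[where f' = "\<lambda>v. ?D v y - ?D u0 y" and S = "ball u0 (min \<delta> \<rho>)"])
          fix v assume v: "v \<in> ball u0 (min \<delta> \<rho>)"
          have "((\<lambda>v. F (v, y)) has_field_derivative ?D v y) (at v)"
            using v by (intro holomorphic_derivI[OF holb[OF y]]) auto
          then show "(?f has_field_derivative ?D v y - ?D u0 y) (at v within ball u0 (min \<delta> \<rho>))"
            by (auto intro!: derivative_eq_intros intro: has_field_derivative_at_within)
          show "norm (?D v y - ?D u0 y) \<le> e/2"
            using \<delta>(2)[of "(u0, y)" "(v, y)"] v y \<rho>
            by (auto simp: dist_Pair_Pair dist_commute dist_norm norm_minus_commute)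
        qed (use h \<delta> \<rho> in \<open>auto simp: dist_norm\<close>)
        moreover have "?q h y - ?D u0 y = (?f (u0 + h) - ?f u0) / h"
          using h by (simp add: field_simps)
        ultimately have "norm (?q h y - ?D u0 y) \<le> e/2"
          using h by (simp add: norm_divide divide_le_eq)
        then show ?thesis using e by (simp add: dist_norm)
      qed
      then show "\<forall>\<^sub>F h in at 0. \<forall>y\<in>cball y0 \<rho>. dist (?q h y) (?D u0 y) < e"
        unfolding eventually_at using \<delta> \<rho> by (intro exI[of _ "min \<delta> \<rho>"]) auto
    qed
    moreover have "\<forall>\<^sub>F h in at 0. continuous_on (cball y0 \<rho>) (?q h) \<and> ?q h holomorphic_on ball y0 \<rho>"
    proof -
      have "?q h holomorphic_on cball y0 \<rho>" if "dist h 0 < \<rho>" "h \<noteq> 0" for h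
        using \<rho> that by (intro holomorphic_intros sep_holomorphic_slice_snd[OF F])
          (auto simp: dist_norm subset_iff)
      then have "continuous_on (cball y0 \<rho>) (?q h) \<and> ?q h holomorphic_on ball y0 \<rho>"
        if "dist h 0 < \<rho>" "h \<noteq> 0" for h
        using that by (meson ball_subset_cball holomorphic_on_subset holomorphic_on_imp_continuous_on)
      then show ?thesis
        unfolding eventually_at using \<rho> by (intro exI[of _ \<rho>]) auto
    qed
    ultimately have "?D u0 holomorphic_on ball y0 \<rho>"
      using holomorphic_uniform_limit[of y0 \<rho> ?q "at 0" "?D u0"] by (auto simp: trivial_limit_at)
    then show "?D u0 field_differentiable at y0"
      using \<rho> by (intro holomorphic_on_imp_differentiable_at) auto
  qed
  then show ?thesis using cont by (auto simp: sep_holomorphic_on_def)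
qed

lemma sep_holomorphic_partial_snd:
  assumes S: "open S" and F: "sep_holomorphic_on F S"
  shows "sep_holomorphic_on (\<lambda>(u, y). deriv (\<lambda>t. F (u, t)) y) S"
  using sep_holomorphic_swap[OF sep_holomorphic_partial_fst[OF open_swap_image[OF S] sep_holomorphic_swap[OF F]]]
  by (simp add: image_image case_prod_unfold o_def)

text \<open>The analytic half of Osgood's lemma: both partial derivatives exist and one of them is jointly
continuous, which is enough for total differentiability.\<close>

lemma sep_holomorphic_has_derivative:
  assumes S: "open S" and F: "sep_holomorphic_on F S" and z: "(u, y) \<in> S"
  shows "(F has_derivative (\<lambda>(h, k). deriv (\<lambda>v. F (v, y)) u * h + deriv (\<lambda>t. F (u, t)) y * k)) (at (u, y))"
proof -
  obtain \<rho> where \<rho>: "\<rho> > 0" "cball u \<rho> \<times> cball y \<rho> \<subseteq> S"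
    using open_contains_polydisc[OF S z] .
  let ?X = "ball u \<rho>" and ?Y = "ball y \<rho>"
  have sub: "?X \<times> ?Y \<subseteq> S" using \<rho> by (auto simp: subset_iff)
  have at: "at (u, y) within ?X \<times> ?Y = at (u, y)"
    using \<rho> by (intro at_within_open open_Times) auto
  have fd: "((\<lambda>v. F (v, y)) has_field_derivative deriv (\<lambda>v. F (v, y)) u) (at u)"
     "((\<lambda>t. F (u, t)) has_field_derivative deriv (\<lambda>t. F (u, t)) y) (at y)" if "(u, y) \<in> S" for u y
    using F that unfolding sep_holomorphic_on_def
    by (auto simp: field_differentiable_derivI)
  have "((\<lambda>(v, t). F (v, t)) has_derivative
      (\<lambda>(h, k). deriv (\<lambda>v. F (v, y)) u * h + blinfun_mult_right (deriv (\<lambda>t. F (u, t)) y) k)) (at (u, y) within ?X \<times> ?Y)"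
  proof (rule has_derivative_partialsI[where fy = "\<lambda>v t. blinfun_mult_right (deriv (\<lambda>t. F (v, t)) t)"])
    show "((\<lambda>v. F (v, y)) has_derivative (*) (deriv (\<lambda>v. F (v, y)) u)) (at u within ?X)"
      using fd(1)[OF z] unfolding has_field_derivative_def by (rule has_derivative_at_withinI)
    show "((\<lambda>t. F (v, t)) has_derivative blinfun_apply (blinfun_mult_right (deriv (\<lambda>t. F (v, t)) t))) (at t within ?Y)"
      if "v \<in> ?X" "t \<in> ?Y" for v t
    proof -
      have "(v, t) \<in> S" using sub that by auto
      from fd(2)[OF this] show ?thesis
        unfolding has_field_derivative_def by (simp add: has_derivative_at_withinI)
    qed
    have "isCont (\<lambda>z. deriv (\<lambda>t. F (fst z, t)) (snd z)) (u, y)"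
      using continuous_partial_snd[OF S F] S z by (simp add: continuous_on_eq_continuous_at)
    from bounded_linear.continuous[OF bounded_linear_blinfun_mult_right this]
    show "continuous (at (u, y) within ?X \<times> ?Y) (\<lambda>(v, t). blinfun_mult_right (deriv (\<lambda>t. F (v, t)) t))"
      by (simp add: at case_prod_unfold)
  qed (use \<rho> in auto)
  then show ?thesis unfolding at by simp
qed

lemma holomorphic2_on_slices:
  assumes "holomorphic2_on F S" "(u, y) \<in> S"
  shows "(\<lambda>v. F (v, y)) field_differentiable at u" "(\<lambda>t. F (u, t)) field_differentiable at y"
proof -
  obtain A B where AB: "(F has_derivative (\<lambda>(h, k). A * h + B * k)) (at (u, y))"
    using assms unfolding holomorphic2_on_def by blast
  have "((\<lambda>v. F (v, y)) has_derivative (\<lambda>h. (\<lambda>(h, k). A * h + B * k) (h, 0))) (at u)"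
    by (rule has_derivative_compose[of "\<lambda>v. (v, y)" _ _ _ F, OF _ AB]) (auto intro!: derivative_eq_intros)
  then show "(\<lambda>v. F (v, y)) field_differentiable at u"
    by (auto simp: field_differentiable_def has_field_derivative_def intro!: exI[of _ A] elim!: has_derivative_eq_rhs)
  have "((\<lambda>t. F (u, t)) has_derivative (\<lambda>k. (\<lambda>(h, k). A * h + B * k) (0, k))) (at y)"
    by (rule has_derivative_compose[of "\<lambda>t. (u, t)" _ _ _ F, OF _ AB]) (auto intro!: derivative_eq_intros)
  then show "(\<lambda>t. F (u, t)) field_differentiable at y"
    by (auto simp: field_differentiable_def has_field_derivative_def intro!: exI[of _ B] elim!: has_derivative_eq_rhs)
qed

lemma holomorphic2_on_imp_continuous_on:
  assumes "holomorphic2_on F S"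
  shows "continuous_on S F"
  using assms unfolding holomorphic2_on_def
  by (meson continuous_at_imp_continuous_on has_derivative_continuous)

lemma holomorphic2_on_iff_separately:
  assumes "open S"
  shows "holomorphic2_on F S \<longleftrightarrow> sep_holomorphic_on F S"
proof
  assume "holomorphic2_on F S"
  then show "sep_holomorphic_on F S"
    unfolding sep_holomorphic_on_def
    by (auto dest: holomorphic2_on_slices holomorphic2_on_imp_continuous_on)
next
  assume "sep_holomorphic_on F S"
  then show "holomorphic2_on F S"
    unfolding holomorphic2_on_def using sep_holomorphic_has_derivative[OF assms] by fast
qed

lemma holomorphic2_on_partial_fst:
  assumes "open S" "holomorphic2_on F S"
  shows "holomorphic2_on (\<lambda>(u, y). deriv (\<lambda>v. F (v, y)) u) S"
  using assms sep_holomorphic_partial_fst holomorphic2_on_iff_separately by blast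

lemma holomorphic2_on_partial_snd:
  assumes "open S" "holomorphic2_on F S"
  shows "holomorphic2_on (\<lambda>(u, y). deriv (\<lambda>t. F (u, t)) y) S"
  using assms sep_holomorphic_partial_snd holomorphic2_on_iff_separately by blast

lemma holomorphic2_on_uniform_limit:
  assumes S: "open S" and f: "\<And>n::nat. holomorphic2_on (f n) S" and lim: "uniform_limit S f F sequentially"
  shows "holomorphic2_on F S"
  unfolding holomorphic2_on_iff_separately[OF S] sep_holomorphic_on_def
proof (intro conjI allI impI)
  show "continuous_on S F"
    by (rule uniform_limit_theorem[OF _ lim]) (simp_all add: f holomorphic2_on_imp_continuous_on)
  fix u y assume z: "(u, y) \<in> S"
  obtain \<rho> where \<rho>: "\<rho> > 0" "cball u \<rho> \<times> cball y \<rho> \<subseteq> S"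
    using open_contains_polydisc[OF S z] .
  note sep = f[unfolded holomorphic2_on_iff_separately[OF S]]
  have 1: "(\<lambda>v. f n (v, y)) holomorphic_on cball u \<rho>" for n
    by (rule sep_holomorphic_slice[OF sep]) (use \<rho> in auto)
  have "uniform_limit (cball u \<rho>) (\<lambda>n v. f n (v, y)) (\<lambda>v. F (v, y)) sequentially"
    by (rule uniform_limit_compose'[OF lim]) (use \<rho> in auto)
  then have "(\<lambda>v. F (v, y)) holomorphic_on ball u \<rho>"
    by (rule holomorphic_uniform_limit[rotated])
      (use 1 holomorphic_on_subset[OF 1 ball_subset_cball] in
        \<open>simp_all add: holomorphic_on_imp_continuous_on\<close>)
  then show "(\<lambda>v. F (v, y)) field_differentiable at u"
    using \<rho> by (intro holomorphic_on_imp_differentiable_at) auto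
  have 2: "(\<lambda>t. f n (u, t)) holomorphic_on cball y \<rho>" for n
    by (rule sep_holomorphic_slice_snd[OF sep]) (use \<rho> in auto)
  have "uniform_limit (cball y \<rho>) (\<lambda>n t. f n (u, t)) (\<lambda>t. F (u, t)) sequentially"
    by (rule uniform_limit_compose'[OF lim]) (use \<rho> in auto)
  then have "(\<lambda>t. F (u, t)) holomorphic_on ball y \<rho>"
    by (rule holomorphic_uniform_limit[rotated])
      (use 2 holomorphic_on_subset[OF 2 ball_subset_cball] in
        \<open>simp_all add: holomorphic_on_imp_continuous_on\<close>)
  then show "(\<lambda>t. F (u, t)) field_differentiable at y"
    using \<rho> by (intro holomorphic_on_imp_differentiable_at) auto
qed

section \<open>Closure properties, division by a coordinate, local coordinates\<close>

text \<open>The closure properties are stated in terms of the projections, so that they can be applied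
backwards as introduction rules.\<close>

lemma holomorphic2_on_const: "holomorphic2_on (\<lambda>z. c) S"
  unfolding holomorphic2_on_def
proof
  fix z :: "complex \<times> complex"
  have "((\<lambda>z. c) has_derivative (\<lambda>(h, k). 0 * h + 0 * k)) (at z)"
    by (auto intro!: derivative_eq_intros)
  then show "\<exists>A B. ((\<lambda>z. c) has_derivative (\<lambda>(h, k). A * h + B * k)) (at z)" by blast
qed

lemma holomorphic2_on_fst: "holomorphic2_on fst S"
  unfolding holomorphic2_on_def
proof
  fix z :: "complex \<times> complex"
  have "(fst has_derivative (\<lambda>(h, k). 1 * h + 0 * k)) (at z)"
    by (auto intro!: derivative_eq_intros simp: case_prod_unfold fun_eq_iff)
  then show "\<exists>A B. (fst has_derivative (\<lambda>(h, k). A * h + B * k)) (at z)" by blast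
qed

lemma holomorphic2_on_snd: "holomorphic2_on snd S"
  unfolding holomorphic2_on_def
proof
  fix z :: "complex \<times> complex"
  have "(snd has_derivative (\<lambda>(h, k). 0 * h + 1 * k)) (at z)"
    by (auto intro!: derivative_eq_intros simp: case_prod_unfold fun_eq_iff)
  then show "\<exists>A B. (snd has_derivative (\<lambda>(h, k). A * h + B * k)) (at z)" by blast
qed

lemma holomorphic2_on_compose2:
  assumes F: "holomorphic2_on F T" and g: "holomorphic2_on g S" and h: "holomorphic2_on h S"
    and T: "\<And>z. z \<in> S \<Longrightarrow> (g z, h z) \<in> T"
  shows "holomorphic2_on (\<lambda>z. F (g z, h z)) S"
  unfolding holomorphic2_on_def
proof
  fix z assume z: "z \<in> S"
  obtain A B where AB: "(F has_derivative (\<lambda>(h, k). A * h + B * k)) (at (g z, h z))"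
    using F T[OF z] unfolding holomorphic2_on_def by blast
  obtain A1 B1 where 1: "(g has_derivative (\<lambda>(h, k). A1 * h + B1 * k)) (at z)"
    using g z unfolding holomorphic2_on_def by blast
  obtain A2 B2 where 2: "(h has_derivative (\<lambda>(h, k). A2 * h + B2 * k)) (at z)"
    using h z unfolding holomorphic2_on_def by blast
  have "((\<lambda>z. F (g z, h z)) has_derivative
      (\<lambda>w. (\<lambda>(h, k). A * h + B * k) ((\<lambda>(h, k). A1 * h + B1 * k) w, (\<lambda>(h, k). A2 * h + B2 * k) w))) (at z)"
    by (rule has_derivative_compose[OF has_derivative_Pair[OF 1 2] AB])
  then have "((\<lambda>z. F (g z, h z)) has_derivative
      (\<lambda>(h, k). (A * A1 + B * A2) * h + (A * B1 + B * B2) * k)) (at z)"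
    by (rule has_derivative_eq_rhs) (auto simp: fun_eq_iff algebra_simps)
  then show "\<exists>A B. ((\<lambda>z. F (g z, h z)) has_derivative (\<lambda>(h, k). A * h + B * k)) (at z)" by blast
qed

lemma holomorphic2_on_compose:
  assumes f: "f holomorphic_on T" "open T" and g: "holomorphic2_on g S"
    and T: "\<And>z. z \<in> S \<Longrightarrow> g z \<in> T"
  shows "holomorphic2_on (\<lambda>z. f (g z)) S"
  unfolding holomorphic2_on_def
proof
  fix z assume z: "z \<in> S"
  have f': "(f has_derivative (*) (deriv f (g z))) (at (g z))"
    using holomorphic_derivI[OF f T[OF z]] by (simp add: has_field_derivative_def)
  obtain A1 B1 where 1: "(g has_derivative (\<lambda>(h, k). A1 * h + B1 * k)) (at z)"
    using g z unfolding holomorphic2_on_def by blast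
  have "((\<lambda>z. f (g z)) has_derivative
      (\<lambda>(h, k). (deriv f (g z) * A1) * h + (deriv f (g z) * B1) * k)) (at z)"
    using has_derivative_compose[OF 1 f']
    by (rule has_derivative_eq_rhs) (auto simp: fun_eq_iff algebra_simps)
  then show "\<exists>A B. ((\<lambda>z. f (g z)) has_derivative (\<lambda>(h, k). A * h + B * k)) (at z)" by blast
qed

lemma holomorphic2_on_add:
  assumes "holomorphic2_on f S" "holomorphic2_on g S"
  shows "holomorphic2_on (\<lambda>z. f z + g z) S"
proof -
  have "holomorphic2_on (\<lambda>z. fst z + snd z) UNIV"
    unfolding holomorphic2_on_def
    by (auto intro!: exI[of _ 1] derivative_eq_intros simp: case_prod_unfold)
  from holomorphic2_on_compose2[OF this assms] show ?thesis by simp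
qed

lemma holomorphic2_on_mult:
  assumes "holomorphic2_on f S" "holomorphic2_on g S"
  shows "holomorphic2_on (\<lambda>z. f z * g z) S"
proof -
  have "((\<lambda>z. fst z * snd z) has_derivative (\<lambda>(h, k). y * h + u * k)) (at (u, y))" for u y :: complex
    by (auto intro!: derivative_eq_intros simp: case_prod_unfold)
  then have "holomorphic2_on (\<lambda>z. fst z * snd z) UNIV"
    unfolding holomorphic2_on_def by fast
  from holomorphic2_on_compose2[OF this assms] show ?thesis by simp
qed

lemma holomorphic2_on_diff:
  assumes "holomorphic2_on f S" "holomorphic2_on g S"
  shows "holomorphic2_on (\<lambda>z. f z - g z) S"
  using holomorphic2_on_add[OF assms(1) holomorphic2_on_mult[OF holomorphic2_on_const[of "-1"] assms(2)]]
  by simp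

lemma holomorphic2_on_power:
  assumes "holomorphic2_on f S"
  shows "holomorphic2_on (\<lambda>z. f z ^ n) S"
  by (rule holomorphic2_on_compose[OF _ open_UNIV assms]) (auto intro!: holomorphic_intros)

lemma holomorphic2_on_poly:
  assumes "holomorphic2_on f S"
  shows "holomorphic2_on (\<lambda>z. poly p (f z)) S"
  by (rule holomorphic2_on_compose[OF _ open_UNIV assms]) (auto intro!: holomorphic_intros)

lemma holomorphic2_on_divide:
  assumes "holomorphic2_on f S" "holomorphic2_on g S" "\<And>z. z \<in> S \<Longrightarrow> g z \<noteq> 0"
  shows "holomorphic2_on (\<lambda>z. f z / g z) S"
proof -
  have "holomorphic2_on (\<lambda>z. inverse (g z)) S"
    by (rule holomorphic2_on_compose[OF _ _ assms(2), of _ "- {0}"])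
      (use assms(3) in \<open>auto intro!: holomorphic_intros\<close>)
  from holomorphic2_on_mult[OF assms(1) this] show ?thesis by (simp add: field_simps)
qed

lemmas holomorphic2_intros = holomorphic2_on_const holomorphic2_on_fst holomorphic2_on_snd
  holomorphic2_on_add holomorphic2_on_mult holomorphic2_on_diff holomorphic2_on_power
  holomorphic2_on_poly holomorphic2_on_divide

lemma holomorphic2_on_sum:
  assumes "\<And>i. i \<in> I \<Longrightarrow> holomorphic2_on (f i) S"
  shows "holomorphic2_on (\<lambda>z. \<Sum>i\<in>I. f i z) S"
  using assms by (induction I rule: infinite_finite_induct)
    (auto intro: holomorphic2_on_const holomorphic2_on_add)

lemma holomorphic2_on_subset: "holomorphic2_on F S \<Longrightarrow> T \<subseteq> S \<Longrightarrow> holomorphic2_on F T"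
  unfolding holomorphic2_on_def by blast

lemma holomorphic2_on_cong_open:
  assumes "open S" "holomorphic2_on F S" "\<And>z. z \<in> S \<Longrightarrow> F z = G z"
  shows "holomorphic2_on G S"
  using assms unfolding holomorphic2_on_def by (meson has_derivative_transform_within_open)

text \<open>A holomorphic function that vanishes on the line \<open>u = 0\<close> is divisible by \<open>u\<close>. The quotient is
extended by the partial derivative in \<open>u\<close>. It is jointly continuous by the mean value inequality,
so in the variable \<open>u\<close> the possible singularity at \<open>u = 0\<close> is removable, and along the line it is
a partial derivative, hence holomorphic in \<open>y\<close>.\<close>

lemma holomorphic2_on_divide_fst:
  assumes S: "open S" and F: "holomorphic2_on F S" and F0: "\<And>y. (0, y) \<in> S \<Longrightarrow> F (0, y) = 0"
  obtains G where "holomorphic2_on G S" "\<And>u y. (u, y) \<in> S \<Longrightarrow> F (u, y) = u * G (u, y)"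
proof -
  let ?D = "\<lambda>u y. deriv (\<lambda>v. F (v, y)) u"
  define G where "G = (\<lambda>(u, y). if u = 0 then ?D 0 y else F (u, y) / u)"
  have sep: "sep_holomorphic_on F S" and sepD: "sep_holomorphic_on (\<lambda>(u, y). ?D u y) S"
    using F holomorphic2_on_iff_separately[OF S] sep_holomorphic_partial_fst[OF S] by blast+
  let ?S' = "S \<inter> {z. fst z \<noteq> 0}"
  have S': "open ?S'"
    by (intro open_Int S open_Collect_neq continuous_intros)
  have "holomorphic2_on (\<lambda>z. F z / fst z) ?S'"
    by (intro holomorphic2_on_divide holomorphic2_on_fst holomorphic2_on_subset[OF F]) auto
  then have "holomorphic2_on G ?S'"
    by (rule holomorphic2_on_cong_open[OF S']) (auto simp: G_def)
  then have sepG': "sep_holomorphic_on G ?S'"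
    using holomorphic2_on_iff_separately[OF S'] by blast
  have G0: "isCont G (0, y0)" if z: "(0, y0) \<in> S" for y0
  proof -
    have "isCont (\<lambda>(u, y). ?D u y) (0, y0)"
      using sepD S z unfolding sep_holomorphic_on_def by (simp add: continuous_on_eq_continuous_at)
    note cont = this[unfolded continuous_at_eps_delta, rule_format]
    obtain \<rho> where \<rho>: "\<rho> > 0" "cball 0 \<rho> \<times> cball y0 \<rho> \<subseteq> S"
      using open_contains_polydisc[OF S z] .
    show ?thesis
      unfolding continuous_at_eps_delta
    proof safe
      fix e :: real assume e: "e > 0"
      obtain \<delta>0 where \<delta>0: "\<delta>0 > 0" "\<And>u y. dist (u, y) (0, y0) < \<delta>0 \<Longrightarrow> dist (?D u y) (?D 0 y0) < e/2"
        using cont[of "e/2"] e by (fastforce simp del: dist_Pair_Pair)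
      define \<delta> where "\<delta> = min \<delta>0 \<rho> / 2"
      have \<delta>: "\<delta> > 0" "\<delta> < \<rho>" "2 * \<delta> \<le> \<delta>0" using \<delta>0 \<rho> by (auto simp: \<delta>_def)
      have D: "norm (?D u y - ?D 0 y0) < e/2" if "norm u < \<delta>" "dist y y0 < \<delta>" for u y
      proof -
        have "dist (u, y) (0, y0) \<le> dist u 0 + dist y y0"
          unfolding dist_prod_def fst_conv snd_conv by (rule sqrt_sum_squares_le_sum) auto
        then show ?thesis using \<delta>0(2)[of u y] \<delta> that by (simp add: dist_norm)
      qed
      have "dist (G (u, y)) (G (0, y0)) < e" if "dist (u, y) (0, y0) < \<delta>" for u y
      proof (cases "u = 0")
        case True
        then show ?thesis
          using D[of u y] e dist_snd_le[of "(u, y)" "(0, y0)"] that \<delta> by (simp add: G_def dist_norm)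
      next
        case False
        have u: "norm u < \<delta>" and y: "dist y y0 < \<delta>"
          using that dist_fst_le[of "(u, y)" "(0, y0)"] dist_snd_le[of "(u, y)" "(0, y0)"] by auto
        have y': "y \<in> cball y0 \<rho>" using y \<delta> by (simp add: dist_commute)
        let ?f = "\<lambda>v. F (v, y) - v * ?D 0 y0"
        have "norm (?f u - ?f 0) \<le> e/2 * norm (u - 0)"
        proof (rule field_differentiable_bound[where f' = "\<lambda>v. ?D v y - ?D 0 y0" and S = "ball 0 \<delta>"])
          fix v :: complex assume v: "v \<in> ball 0 \<delta>"
          then have "(v, y) \<in> S" using \<rho> \<delta> y' by auto
          then have "((\<lambda>v. F (v, y)) has_field_derivative ?D v y) (at v)"
            using sep unfolding sep_holomorphic_on_def by (auto simp: field_differentiable_derivI)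
          then show "(?f has_field_derivative ?D v y - ?D 0 y0) (at v within ball 0 \<delta>)"
            by (auto intro!: derivative_eq_intros intro: has_field_derivative_at_within)
          show "norm (?D v y - ?D 0 y0) \<le> e/2"
            using D[of v y] v y by auto
        qed (use u \<delta> in auto)
        moreover have "F (0, y) = 0" using \<rho> y' by (intro F0) auto
        ultimately have "norm ((F (u, y) - u * ?D 0 y0) / u) \<le> e/2"
          using False by (simp add: norm_divide divide_le_eq)
        then show ?thesis using e False by (simp add: G_def dist_norm field_simps)
      qed
      then show "\<exists>d>0. \<forall>z. dist z (0, y0) < d \<longrightarrow> dist (G z) (G (0, y0)) < e"
        using \<delta> by (intro exI[of _ \<delta>]) auto
    qed
  qed
  have contG: "continuous_on S G"
  proof -
    have "isCont G (u, y)" if "(u, y) \<in> S" for u y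
      using G0[of y] that sepG' S' unfolding sep_holomorphic_on_def
      by (cases "u = 0") (auto simp: continuous_on_eq_continuous_at)
    then show ?thesis by (auto intro!: continuous_at_imp_continuous_on)
  qed
  have "(\<lambda>v. G (v, y)) field_differentiable at u \<and> (\<lambda>t. G (u, t)) field_differentiable at y"
    if z: "(u, y) \<in> S" for u y
  proof (cases "u = 0")
    case False
    then show ?thesis using z sepG' unfolding sep_holomorphic_on_def by auto
  next
    case True
    obtain \<rho> where \<rho>: "\<rho> > 0" "cball 0 \<rho> \<times> cball y \<rho> \<subseteq> S"
      using open_contains_polydisc[OF S z[unfolded True]] .
    have "(\<lambda>v. G (v, y)) holomorphic_on ball 0 \<rho>"
    proof (rule no_isolated_singularity)
      have "(\<lambda>v. (v, y)) ` ball 0 \<rho> \<subseteq> S" using \<rho> by auto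
      then show "continuous_on (ball 0 \<rho>) (\<lambda>v. G (v, y))"
        by (intro continuous_on_compose2[OF contG] continuous_intros)
      show "(\<lambda>v. G (v, y)) holomorphic_on ball 0 \<rho> - {0}"
        by (rule sep_holomorphic_slice[OF sepG']) (use \<rho> in \<open>auto simp: subset_iff\<close>)
    qed auto
    then have "(\<lambda>v. G (v, y)) field_differentiable at 0"
      using \<rho> by (intro holomorphic_on_imp_differentiable_at) auto
    moreover have "?D 0 field_differentiable at y"
      using sepD z True unfolding sep_holomorphic_on_def by fastforce
    ultimately show ?thesis using True by (simp add: G_def)
  qed
  then have "holomorphic2_on G S"
    using contG holomorphic2_on_iff_separately[OF S] unfolding sep_holomorphic_on_def by blast
  moreover have "F (u, y) = u * G (u, y)" if "(u, y) \<in> S" for u y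
    using F0 that by (auto simp: G_def)
  ultimately show ?thesis using that by blast
qed

text \<open>The holomorphic inverse function theorem in two variables. The real inverse function theorem
supplies the local inverse; its derivative is the inverse of a complex linear map, hence complex
linear. The domain is first shrunk to the set where the Jacobian determinant \<open>J\<close> is nonzero, so that
the inverse matrix \<open>?M\<close> is available at every point.\<close>

lemma holomorphic2_local_coordinates:
  assumes S: "open S" and F: "holomorphic2_on F S" and G: "holomorphic2_on G S" and z: "(u0, y0) \<in> S"
    and J: "deriv (\<lambda>v. F (v, y0)) u0 * deriv (\<lambda>t. G (u0, t)) y0
          \<noteq> deriv (\<lambda>t. F (u0, t)) y0 * deriv (\<lambda>v. G (v, y0)) u0"
  obtains U V \<psi>' where "(u0, y0) \<in> U" "U \<subseteq> S" "biholomorphism2 U V (\<lambda>z. (F z, G z)) \<psi>'"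
proof -
  define Fu Fy Gu Gy where "Fu = (\<lambda>(u, y). deriv (\<lambda>v. F (v, y)) u)" and "Fy = (\<lambda>(u, y). deriv (\<lambda>t. F (u, t)) y)"
    and "Gu = (\<lambda>(u, y). deriv (\<lambda>v. G (v, y)) u)" and "Gy = (\<lambda>(u, y). deriv (\<lambda>t. G (u, t)) y)"
  note part = Fu_def Fy_def Gu_def Gy_def
  have hol: "holomorphic2_on Fu S" "holomorphic2_on Fy S" "holomorphic2_on Gu S" "holomorphic2_on Gy S"
    unfolding part using F G S by (auto intro: holomorphic2_on_partial_fst holomorphic2_on_partial_snd)
  note cont = hol[THEN holomorphic2_on_imp_continuous_on]
  define J where "J = (\<lambda>z. Fu z * Gy z - Fy z * Gu z)"
  define S' where "S' = S \<inter> J -` (- {0})"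
  have S': "open S'"
    unfolding S'_def J_def
    by (rule continuous_open_preimage[OF _ S]) (auto intro!: continuous_intros cont)
  have z': "(u0, y0) \<in> S'" using z J by (simp add: S'_def J_def part)
  let ?L = "\<lambda>z (h, k). (Fu z * h + Fy z * k, Gu z * h + Gy z * k)"
  let ?M = "\<lambda>z (h, k). ((Gy z / J z) * h + (- Fy z / J z) * k, (- Gu z / J z) * h + (Fu z / J z) * k)"
  have blL: "bounded_linear (?L z)" and blM: "bounded_linear (?M z)" for z
    unfolding case_prod_unfold
    by (intro bounded_linear_Pair bounded_linear_add bounded_linear_const_mult bounded_linear_fst bounded_linear_snd)+
  define f' where "f' = (\<lambda>z. Blinfun (?L z))"
  have f': "blinfun_apply (f' z) = ?L z" for z
    unfolding f'_def by (rule bounded_linear_Blinfun_apply[OF blL])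
  have inverses: "?M z (?L z w) = w" "?L z (?M z w) = w" if "J z \<noteq> 0" for z w
  proof -
    have *: "J z = Fu z * Gy z - Fy z * Gu z" by (simp add: J_def)
    obtain h k where w: "w = (h, k)" by (cases w)
    have "Gy z * (Fu z * h + Fy z * k) - Fy z * (Gu z * h + Gy z * k) = h * J z"
      "- (Gu z * (Fu z * h + Fy z * k)) + Fu z * (Gu z * h + Gy z * k) = k * J z"
      "Fu z * (Gy z * h - Fy z * k) + Fy z * (Fu z * k - Gu z * h) = h * J z"
      "Gu z * (Gy z * h - Fy z * k) + Gy z * (Fu z * k - Gu z * h) = k * J z"
      by (simp_all add: * algebra_simps)
    then show "?M z (?L z w) = w" "?L z (?M z w) = w"
      using that unfolding w by (simp_all add: add_divide_distrib[symmetric] diff_divide_distrib[symmetric] nonzero_divide_eq_eq)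
  qed
  have der: "((\<lambda>z. (F z, G z)) has_derivative blinfun_apply (f' z)) (at z)" if "z \<in> S'" for z
  proof -
    have zS: "(fst z, snd z) \<in> S" using that by (simp add: S'_def)
    note sep = F[unfolded holomorphic2_on_iff_separately[OF S]] G[unfolded holomorphic2_on_iff_separately[OF S]]
    have "((\<lambda>z. (F z, G z)) has_derivative
       (\<lambda>w. ((\<lambda>(h, k). Fu z * h + Fy z * k) w, (\<lambda>(h, k). Gu z * h + Gy z * k) w))) (at z)"
      using has_derivative_Pair[OF sep_holomorphic_has_derivative[OF S sep(1) zS] sep_holomorphic_has_derivative[OF S sep(2) zS]]
      by (simp add: part case_prod_unfold)
    then show ?thesis unfolding f' by (rule has_derivative_eq_rhs) auto
  qed
  have contf': "continuous_on S' f'"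
  proof (rule continuous_on_blinfun_componentwise)
    fix i :: "complex \<times> complex" assume "i \<in> Basis"
    have "continuous_on S' (\<lambda>z. ?L z i)"
      unfolding case_prod_unfold
      by (intro continuous_intros continuous_on_subset[OF cont(1)] continuous_on_subset[OF cont(2)]
         continuous_on_subset[OF cont(3)] continuous_on_subset[OF cont(4)]) (auto simp: S'_def)
    then show "continuous_on S' (\<lambda>z. f' z i)" by (simp add: f')
  qed
  have inv0: "Blinfun (?M (u0, y0)) o\<^sub>L f' (u0, y0) = id_blinfun"
  proof (rule blinfun_eqI)
    fix w
    have "J (u0, y0) \<noteq> 0" using z' by (simp add: S'_def)
    from inverses(1)[OF this] show "(Blinfun (?M (u0, y0)) o\<^sub>L f' (u0, y0)) w = id_blinfun w"
      by (simp only: blinfun_apply_blinfun_compose bounded_linear_Blinfun_apply[OF blM] f' blinfun_apply_id_blinfun id_apply)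
  qed
  obtain U V g g' where UV: "open U" "U \<subseteq> S'" "(u0, y0) \<in> U" "open V"
      "(F (u0, y0), G (u0, y0)) \<in> V" "homeomorphism U V (\<lambda>z. (F z, G z)) g"
      "\<And>y. y \<in> V \<Longrightarrow> (g has_derivative (g' y)) (at y)"
      "\<And>y. y \<in> V \<Longrightarrow> g' y = inv (blinfun_apply (f' (g y)))"
      "\<And>y. y \<in> V \<Longrightarrow> bij (blinfun_apply (f' (g y)))"
  proof (rule inverse_function_theorem[OF S' der contf' z' inv0], assumption, goal_cases)
    case (1 U V g g')
    show ?case by (rule 1(1)[OF 1(2-)])
  qed
  have g': "g' y = ?M (g y)" if y: "y \<in> V" for y
  proof -
    have "g y \<in> S'" using UV(2,6) y by (auto simp: homeomorphism_def)
    then have "J (g y) \<noteq> 0" by (simp add: S'_def)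
    then show ?thesis unfolding UV(8)[OF y] f'
      by (intro inv_equality inverses)
  qed
  have "\<exists>A B. (fst \<circ> g has_derivative (\<lambda>(h, k). A * h + B * k)) (at y) \<and>
     (\<exists>A B. (snd \<circ> g has_derivative (\<lambda>(h, k). A * h + B * k)) (at y))" if y: "y \<in> V" for y
  proof -
    note d = UV(7)[OF y, unfolded g'[OF y]]
    have "(fst \<circ> g has_derivative (\<lambda>(h, k). (Gy (g y) / J (g y)) * h + (- Fy (g y) / J (g y)) * k)) (at y)"
      "(snd \<circ> g has_derivative (\<lambda>(h, k). (- Gu (g y) / J (g y)) * h + (Fu (g y) / J (g y)) * k)) (at y)"
      using has_derivative_fst[OF d] has_derivative_snd[OF d]
      by (simp_all add: o_def case_prod_unfold)
    then show ?thesis by blast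
  qed
  then have "holomorphic2_on (fst \<circ> g) V" "holomorphic2_on (snd \<circ> g) V"
    unfolding holomorphic2_on_def by blast+
  moreover have "U \<subseteq> S" using UV(2) by (auto simp: S'_def)
  ultimately have "biholomorphism2 U V (\<lambda>z. (F z, G z)) g"
    unfolding biholomorphism2_def using UV F G by (auto simp: o_def intro: holomorphic2_on_subset)
  then show ?thesis using that UV(3) \<open>U \<subseteq> S\<close> by blast
qed

section \<open>Smooth zero varieties and Jacobians that vanish on a line\<close>

text \<open>If \<open>g\<close> and \<open>F\<close> together form local coordinates, then the curve \<open>g = 0\<close> is a coordinate line on
which \<open>F\<close> is the remaining coordinate. This gives smoothness of the curve and invertibility of the
restriction of \<open>F\<close> at the same time.\<close>

lemma restriction_coordinates:
  assumes S: "open S" and g: "holomorphic2_on g S" and F: "holomorphic2_on F S"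
    and z: "(u0, y0) \<in> S" and g0: "g (u0, y0) = 0"
    and J: "deriv (\<lambda>v. g (v, y0)) u0 * deriv (\<lambda>t. F (u0, t)) y0
          \<noteq> deriv (\<lambda>t. g (u0, t)) y0 * deriv (\<lambda>v. F (v, y0)) u0"
  shows "smooth_zero_variety_at S g (u0, y0)"
    and "restr_local_biholomorphism_at F (zero_variety S g) (u0, y0)"
proof -
  obtain U V \<psi>' where U: "(u0, y0) \<in> U" "U \<subseteq> S" and bih: "biholomorphism2 U V (\<lambda>z. (g z, F z)) \<psi>'"
    using holomorphic2_local_coordinates[OF S g F z J] .
  show "smooth_zero_variety_at S g (u0, y0)"
    unfolding smooth_zero_variety_at_def
  proof (intro conjI exI)
    show "(u0, y0) \<in> zero_variety S g" using z g0 by (simp add: zero_variety_def)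
    show "holomorphic2_on (\<lambda>z. 1) U" by (rule holomorphic2_on_const)
    show "\<forall>t\<in>U. 1 \<noteq> (0 :: complex) \<and> g t = fst (g t, F t) * 1" by simp
  qed (use U bih in auto)
  have op: "open U" "open V" and hom: "homeomorphism U V (\<lambda>z. (g z, F z)) \<psi>'"
    and hol: "holomorphic2_on (fst \<circ> \<psi>') V" "holomorphic2_on (snd \<circ> \<psi>') V"
    using bih unfolding biholomorphism2_def by auto
  define W where "W = {t. (0, t) \<in> V}"
  define G where "G = (\<lambda>t. \<psi>' (0, t))"
  have hom': "\<And>z. z \<in> U \<Longrightarrow> (g z, F z) \<in> V" "\<And>z. z \<in> U \<Longrightarrow> \<psi>' (g z, F z) = z"
    "\<And>z. z \<in> V \<Longrightarrow> \<psi>' z \<in> U" "\<And>z. z \<in> V \<Longrightarrow> (g (\<psi>' z), F (\<psi>' z)) = z"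
    "continuous_on V \<psi>'"
    using hom by (auto simp: homeomorphism_def)
  have CU: "zero_variety S g \<inter> U = {z \<in> U. g z = 0}"
    using U by (auto simp: zero_variety_def)
  show "restr_local_biholomorphism_at F (zero_variety S g) (u0, y0)"
    unfolding restr_local_biholomorphism_at_def
  proof (rule conjI, goal_cases)
    case 1
    show ?case using z g0 by (simp add: zero_variety_def)
  next
    case 2
    show ?case
    proof (rule exI[of _ U], rule exI[of _ W], rule exI[of _ G], intro conjI)
      have "W = (\<lambda>t. (0, t)) -` V" by (auto simp: W_def)
      then show "open W"
        by (simp add: op open_vimage continuous_on_Pair)
      show "homeomorphism (zero_variety S g \<inter> U) W F G"
        unfolding CU
      proof (rule homeomorphismI)
        show "continuous_on {z \<in> U. g z = 0} F"
          using holomorphic2_on_imp_continuous_on[OF F] U by (auto intro: continuous_on_subset)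
        show "continuous_on W G"
          unfolding G_def by (rule continuous_on_compose2[OF hom'(5)]) (auto intro!: continuous_intros simp: W_def)
        show "F ` {z \<in> U. g z = 0} \<subseteq> W" using hom'(1) by (auto simp: W_def) metis
        show "G ` W \<subseteq> {z \<in> U. g z = 0}" using hom'(3,4) by (fastforce simp: W_def G_def)
        show "G (F z) = z" if "z \<in> {z \<in> U. g z = 0}" for z
          using hom'(2)[of z] that by (simp add: G_def)
        show "F (G t) = t" if "t \<in> W" for t
          using hom'(4)[of "(0, t)"] that by (simp add: G_def W_def)
      qed
      have "(\<lambda>t. (fst \<circ> \<psi>') (0, t)) holomorphic_on W" "(\<lambda>t. (snd \<circ> \<psi>') (0, t)) holomorphic_on W"
        using hol unfolding holomorphic2_on_iff_separately[OF op(2)]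
        by (intro sep_holomorphic_slice_snd[of _ V]; force simp: W_def)+
      then show "fst \<circ> G holomorphic_on W" "snd \<circ> G holomorphic_on W"
        by (simp_all add: G_def o_def)
    qed (use U op F in \<open>auto intro: holomorphic2_on_subset\<close>)
  qed
qed

lemma deriv_eq_open:
  fixes S :: "(complex \<times> complex) set"
  assumes "open S" "(u, y) \<in> S" "\<And>z. z \<in> S \<Longrightarrow> F z = G z"
  shows "deriv (\<lambda>v. F (v, y)) u = deriv (\<lambda>v. G (v, y)) u"
    and "deriv (\<lambda>t. F (u, t)) y = deriv (\<lambda>t. G (u, t)) y"
proof -
  obtain \<rho> where \<rho>: "\<rho> > 0" "cball u \<rho> \<times> cball y \<rho> \<subseteq> S"
    using open_contains_polydisc[OF assms(1,2)] .
  have "\<forall>\<^sub>F v in nhds u. v \<in> ball u \<rho>" "\<forall>\<^sub>F t in nhds y. t \<in> ball y \<rho>"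
    using \<rho> by (simp_all only: eventually_nhds_in_open open_ball centre_in_ball)
  then have "\<forall>\<^sub>F v in nhds u. F (v, y) = G (v, y)" "\<forall>\<^sub>F t in nhds y. F (u, t) = G (u, t)"
    using \<rho> by (auto elim!: eventually_mono intro!: assms(3))
  then show "deriv (\<lambda>v. F (v, y)) u = deriv (\<lambda>v. G (v, y)) u"
    "deriv (\<lambda>t. F (u, t)) y = deriv (\<lambda>t. G (u, t)) y"
    by (simp_all add: deriv_cong_ev)
qed

definition jacobian :: "(complex \<times> complex \<Rightarrow> complex) \<Rightarrow> (complex \<times> complex \<Rightarrow> complex) \<Rightarrow> complex \<times> complex \<Rightarrow> complex"
  where "jacobian F G = (\<lambda>(u, y). deriv (\<lambda>v. F (v, y)) u * deriv (\<lambda>t. G (u, t)) y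
     - deriv (\<lambda>t. F (u, t)) y * deriv (\<lambda>v. G (v, y)) u)"

text \<open>The Jacobian vanishes to second order on \<open>u = 0\<close> because the \<open>y\<close>-derivatives of \<open>F\<close> and \<open>G\<close>
are \<open>u\<^sup>2\<close> times those of \<open>E\<close> and \<open>N\<close>. On the line \<open>u = 0\<close> the \<open>u\<close>-derivatives of \<open>F\<close> and
\<open>G\<close> are \<open>1\<close> and \<open>- 1\<close>, so the quotient \<open>w\<close> restricts there to the \<open>y\<close>-derivative of
\<open>E + N\<close>: only the second-order coefficients matter.\<close>

lemma jacobian_factors:
  assumes S: "open S" and E: "holomorphic2_on E S" and N: "holomorphic2_on N S"
    and F: "\<And>u y. (u, y) \<in> S \<Longrightarrow> F (u, y) = u + u\<^sup>2 * E (u, y)"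
    and G: "\<And>u y. (u, y) \<in> S \<Longrightarrow> G (u, y) = - u + u\<^sup>2 * N (u, y)"
  obtains w where "holomorphic2_on w S" "\<And>u y. (u, y) \<in> S \<Longrightarrow> jacobian F G (u, y) = u\<^sup>2 * w (u, y)"
    "\<And>y. (0, y) \<in> S \<Longrightarrow> w (0, y) = deriv (\<lambda>t. E (0, t)) y + deriv (\<lambda>t. N (0, t)) y"
    "holomorphic2_on F S" "\<And>y. (0, y) \<in> S \<Longrightarrow> deriv (\<lambda>v. F (v, y)) 0 = 1"
proof -
  define F0 G0 where "F0 = (\<lambda>z. fst z + (fst z)\<^sup>2 * E z)" and "G0 = (\<lambda>z. 0 - fst z + (fst z)\<^sup>2 * N z)"
  have FG: "F z = F0 z" "G z = G0 z" if "z \<in> S" for z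
    using F[of "fst z" "snd z"] G[of "fst z" "snd z"] that by (auto simp: F0_def G0_def)
  have derivs: "deriv (\<lambda>v. F (v, y)) u = deriv (\<lambda>v. F0 (v, y)) u"
    "deriv (\<lambda>t. F (u, t)) y = deriv (\<lambda>t. F0 (u, t)) y"
    "deriv (\<lambda>v. G (v, y)) u = deriv (\<lambda>v. G0 (v, y)) u"
    "deriv (\<lambda>t. G (u, t)) y = deriv (\<lambda>t. G0 (u, t)) y" if "(u, y) \<in> S" for u y
    using deriv_eq_open[OF S that, of F F0] deriv_eq_open[OF S that, of G G0] FG by auto
  have hol0: "holomorphic2_on F0 S" "holomorphic2_on G0 S"
    unfolding F0_def G0_def by (intro holomorphic2_intros E N)+
  have hol: "holomorphic2_on F S" "holomorphic2_on G S"
    using holomorphic2_on_cong_open[OF S hol0(1)] holomorphic2_on_cong_open[OF S hol0(2)] FG by auto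
  \<comment> \<open>The mixed terms of the Jacobian with the common factor \<open>u\<^sup>2\<close> of the \<open>y\<close>-derivatives taken out.\<close>
  define w where "w = (\<lambda>z. (\<lambda>(u, y). deriv (\<lambda>v. F (v, y)) u) z * (\<lambda>(u, y). deriv (\<lambda>t. N (u, t)) y) z
     - (\<lambda>(u, y). deriv (\<lambda>v. G (v, y)) u) z * (\<lambda>(u, y). deriv (\<lambda>t. E (u, t)) y) z)"
  have "holomorphic2_on w S"
    unfolding w_def using hol E N S
    by (intro holomorphic2_on_diff holomorphic2_on_mult holomorphic2_on_partial_fst holomorphic2_on_partial_snd)
  moreover have "jacobian F G (u, y) = u\<^sup>2 * w (u, y)" if z: "(u, y) \<in> S" for u y
  proof -
    have "deriv (\<lambda>t. G (u, t)) y = u\<^sup>2 * deriv (\<lambda>t. N (u, t)) y"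
      unfolding derivs(4)[OF z] G0_def
      using holomorphic2_on_slices(2)[OF N z, THEN field_differentiable_derivI]
      by (auto intro!: DERIV_imp_deriv derivative_eq_intros)
    moreover have "deriv (\<lambda>t. F (u, t)) y = u\<^sup>2 * deriv (\<lambda>t. E (u, t)) y"
      unfolding derivs(2)[OF z] F0_def
      using holomorphic2_on_slices(2)[OF E z, THEN field_differentiable_derivI]
      by (auto intro!: DERIV_imp_deriv derivative_eq_intros)
    ultimately show ?thesis by (simp add: jacobian_def w_def algebra_simps)
  qed
  moreover have F1: "deriv (\<lambda>v. F (v, y)) 0 = 1" if z: "(0, y) \<in> S" for y
    unfolding derivs(1)[OF z] F0_def
    using holomorphic2_on_slices(1)[OF E z, THEN field_differentiable_derivI]
    by (auto intro!: DERIV_imp_deriv derivative_eq_intros)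
  moreover have "w (0, y) = deriv (\<lambda>t. E (0, t)) y + deriv (\<lambda>t. N (0, t)) y" if z: "(0, y) \<in> S" for y
  proof -
    have "deriv (\<lambda>v. G (v, y)) 0 = - 1"
      unfolding derivs(3)[OF z] G0_def
      using holomorphic2_on_slices(1)[OF N z, THEN field_differentiable_derivI]
      by (auto intro!: DERIV_imp_deriv derivative_eq_intros)
    then show ?thesis using F1[OF z] by (simp add: w_def)
  qed
  ultimately show ?thesis using that hol(1) by blast
qed

section \<open>The dynamics near infinity\<close>

text \<open>The dynamics near infinity in the coordinates \<open>u = 1/x\<close> and \<open>t = y/x\<close>. The parameters \<open>(A, B)\<close>
treat both directions at once: forward iteration of a point \<open>(x, y)\<close> of \<open>V\<^sub>+\<close> is \<open>(A, B) = (1, a)\<close>, and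
backward iteration of a point of \<open>V\<^sub>-\<close>, with the two coordinates interchanged, is \<open>(A, B) = (a, 1)\<close>.
The ratio below is \<open>(p(x) - B y) / x\<^sup>d\<close>; the reflected polynomial is \<open>u\<^sup>d p(1/u)\<close>, which makes sense
at \<open>u = 0\<close>.\<close>

definition inf_ratio :: "complex poly \<Rightarrow> complex \<Rightarrow> complex \<times> complex \<Rightarrow> complex" where
  "inf_ratio p B = (\<lambda>(u, t). poly (reflect_poly p) u - B * t * u ^ (degree p - 1))"

text \<open>The map \<open>(x, y) \<mapsto> ((p(x) - B y) / A, x)\<close> in these coordinates. In this form it is also defined for
\<open>A = 0\<close> (constant, the limit of backward iteration as \<open>a\<close> tends to \<open>0\<close>) and at \<open>u = 0\<close>.\<close>

definition inf_step :: "complex poly \<Rightarrow> complex \<Rightarrow> complex \<Rightarrow> complex \<times> complex \<Rightarrow> complex \<times> complex" where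
  "inf_step p A B = (\<lambda>(u, t).
     (A * u ^ degree p / inf_ratio p B (u, t), A * u ^ (degree p - 1) / inf_ratio p B (u, t)))"

text \<open>The quotient of the dominant coordinate by the Boettcher-type function.\<close>

definition inf_factor :: "complex poly \<Rightarrow> complex \<Rightarrow> complex \<Rightarrow> complex \<times> complex \<Rightarrow> complex" where
  "inf_factor p A B z =
     exp (- (\<Sum>k. Ln (inf_ratio p B ((inf_step p A B ^^ k) z)) / of_nat (degree p) ^ Suc k))"

text \<open>The sets \<open>V\<^sub>+\<close> and \<open>V\<^sub>-\<close> in the coordinates \<open>(u, t)\<close>, completed by the line \<open>u = 0\<close>.\<close>

definition inf_nhd :: "real \<Rightarrow> (complex \<times> complex) set" where
  "inf_nhd \<alpha> = {(u, t). norm u < 1 / \<alpha> \<and> norm t < 1}"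

lemma open_inf_nhd: "open (inf_nhd \<alpha>)"
  unfolding inf_nhd_def case_prod_unfold
  by (intro open_Collect_conj open_Collect_less continuous_intros)

locale escape =
  fixes p :: "complex poly" and R r \<alpha> :: real
  assumes monic: "lead_coeff p = 1" and deg: "degree p \<ge> 2"
    and R: "R > 0" and r: "0 < r" "r < 1" and \<alpha>: "\<alpha> > 0"
    and ratio_bound: "\<And>x. norm x \<ge> \<alpha> \<Longrightarrow>
      norm (poly p x / x ^ degree p - 1) + (R + 1) / norm x ^ (degree p - 1) < r"
    and growth_bound: "\<And>x. norm x \<ge> \<alpha> \<Longrightarrow> norm (poly p x) > (2 * R + 1) * norm x"
begin

lemma deg_pos: "degree p - 1 > 0" "degree p > 0" "degree p = Suc (degree p - 1)"
  using deg by auto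

lemma inf_ratio_0: "inf_ratio p B (0, t) = 1"
  using deg_pos monic by (simp add: inf_ratio_def zero_power)

lemma inf_step_0: "inf_step p A B (0, t) = (0, 0)"
  using deg_pos by (simp add: inf_step_def zero_power)

lemma inf_ratio_nz:
  assumes "u \<noteq> 0"
  shows "inf_ratio p B (u, t) = u ^ degree p * (poly p (1 / u) - B * (t / u))"
proof -
  have "u ^ degree p = u ^ (degree p - 1) * u" by (metis deg_pos(3) power_Suc2)
  then have "B * t * u ^ (degree p - 1) = u ^ degree p * (B * (t / u))" using assms by simp
  then show ?thesis
    using assms by (simp add: inf_ratio_def poly_reflect_poly_nz inverse_eq_divide right_diff_distrib)
qed

lemma inf_ratio_close_to_1:
  assumes B: "norm B \<le> R + 1" and z: "z \<in> inf_nhd \<alpha>"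
  shows "norm (inf_ratio p B z - 1) < r"
proof -
  obtain u t where ut: "z = (u, t)" "norm u < 1 / \<alpha>" "norm t < 1"
    using z by (auto simp: inf_nhd_def)
  show ?thesis
  proof (cases "u = 0")
    case True
    then show ?thesis using ut r by (simp add: inf_ratio_0)
  next
    case False
    have x: "norm (1 / u) \<ge> \<alpha>" using ut(2) False \<alpha> by (simp add: norm_divide field_simps)
    have "inf_ratio p B z - 1 = (poly p (1 / u) / (1 / u) ^ degree p - 1) - B * t * u ^ (degree p - 1)"
      using False by (simp add: ut inf_ratio_def poly_reflect_poly_nz inverse_eq_divide power_divide)
    also have "norm \<dots> \<le> norm (poly p (1 / u) / (1 / u) ^ degree p - 1) + norm (B * t * u ^ (degree p - 1))"
      by (rule norm_triangle_ineq4)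
    also have "norm (B * t * u ^ (degree p - 1)) \<le> (R + 1) * 1 * norm u ^ (degree p - 1)"
      unfolding norm_mult norm_power using B ut(3) R by (intro mult_mono) auto
    also have "(R + 1) * 1 * norm u ^ (degree p - 1) = (R + 1) / norm (1 / u) ^ (degree p - 1)"
      by (simp add: norm_divide power_divide)
    finally show ?thesis using ratio_bound[OF x] by linarith
  qed
qed

lemma inf_ratio_nonzero:
  assumes "norm B \<le> R + 1" "z \<in> inf_nhd \<alpha>"
  shows "inf_ratio p B z \<noteq> 0"
  using inf_ratio_close_to_1[OF assms] r by auto

text \<open>The growth bound gives \<open>\<bar>p(x) - B y\<bar> > \<bar>A\<bar> \<bar>x\<bar>\<close>. So the new \<open>t\<close> has norm below \<open>1\<close>, and the new
\<open>u\<close>, which is \<open>u\<close> times the new \<open>t\<close>, does not grow. The hypothesis on \<open>(A, B)\<close> holds for both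
\<open>(1, a)\<close> and \<open>(a, 1)\<close> when \<open>\<bar>a\<bar> \<le> R\<close>.\<close>

lemma inf_step_in_nhd:
  assumes AB: "norm A + norm B \<le> R + 1" and z: "z \<in> inf_nhd \<alpha>"
  shows "inf_step p A B z \<in> inf_nhd \<alpha>"
proof -
  obtain u t where ut: "z = (u, t)" "norm u < 1 / \<alpha>" "norm t < 1"
    using z by (auto simp: inf_nhd_def)
  have B: "norm B \<le> R + 1" using AB norm_ge_zero[of A] by linarith
  show ?thesis
  proof (cases "u = 0")
    case True
    then show ?thesis using ut \<alpha> by (simp add: inf_step_0 inf_nhd_def)
  next
    case False
    let ?x = "1 / u"
    have x: "norm ?x \<ge> \<alpha>" using ut(2) False \<alpha> by (simp add: norm_divide field_simps)
    have "norm (B * (t / u)) \<le> norm B * norm ?x"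
      using ut(3) mult_right_mono[of "norm t" 1 "norm B * norm (1 / u)"]
      by (simp add: norm_mult norm_divide field_simps)
    moreover have "norm A * norm ?x + norm B * norm ?x \<le> (2 * R + 1) * norm ?x"
      using AB R by (simp add: distrib_right[symmetric] mult_right_mono del: norm_divide)
    ultimately have "norm A * norm ?x < norm (poly p ?x - B * (t / u))"
      using growth_bound[OF x] norm_triangle_ineq2[of "poly p ?x" "B * (t / u)"] by linarith
    then have "norm u ^ degree p * (norm A * norm ?x) < norm (inf_ratio p B z)"
      using False by (simp add: ut inf_ratio_nz norm_mult norm_power)
    moreover have "norm u ^ degree p * (norm A * norm ?x) = norm (A * u ^ (degree p - 1))"
      using False by (subst deg_pos(3)) (simp add: norm_mult norm_power norm_divide)
    ultimately have s: "norm (A * u ^ (degree p - 1) / inf_ratio p B z) < 1"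
      using inf_ratio_nonzero[OF B z] by (simp add: norm_divide)
    have "A * u ^ degree p / inf_ratio p B z = u * (A * u ^ (degree p - 1) / inf_ratio p B z)"
      by (subst deg_pos(3)) simp
    then have "norm (A * u ^ degree p / inf_ratio p B z) \<le> norm u"
      using s mult_left_mono[of "norm (A * u ^ (degree p - 1) / inf_ratio p B z)" 1 "norm u"]
      by (simp only: norm_mult[of u]) simp
    with s ut show ?thesis by (simp add: inf_step_def inf_nhd_def)
  qed
qed

lemma inf_orbit_in_nhd:
  assumes "norm A + norm B \<le> R + 1" and "z \<in> inf_nhd \<alpha>"
  shows "(inf_step p A B ^^ k) z \<in> inf_nhd \<alpha>"
  using assms(2) by (induction k) (auto intro: inf_step_in_nhd[OF assms(1)])

lemma inf_orbit_0: "(inf_step p A B ^^ k) (0, t) = (0, if k = 0 then t else 0)"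
  by (induction k) (auto simp: inf_step_0)

lemma inf_factor_0: "inf_factor p A B (0, t) = 1"
  by (simp add: inf_factor_def inf_orbit_0 inf_ratio_0)

lemma holomorphic2_inf_ratio: "holomorphic2_on (inf_ratio p B) S"
  unfolding inf_ratio_def case_prod_unfold by (intro holomorphic2_intros)

lemma holomorphic2_inf_orbit:
  assumes AB: "norm A + norm B \<le> R + 1"
  shows "holomorphic2_on (\<lambda>z. fst ((inf_step p A B ^^ k) z)) (inf_nhd \<alpha>) \<and>
         holomorphic2_on (\<lambda>z. snd ((inf_step p A B ^^ k) z)) (inf_nhd \<alpha>)"
proof (induction k)
  case 0
  show ?case by (auto intro: holomorphic2_intros)
next
  case (Suc k)
  have B: "norm B \<le> R + 1" using AB norm_ge_zero[of A] by linarith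
  let ?z = "\<lambda>z. (inf_step p A B ^^ k) z"
  have "holomorphic2_on (\<lambda>z. inf_ratio p B (fst (?z z), snd (?z z))) (inf_nhd \<alpha>)"
    by (rule holomorphic2_on_compose2[OF holomorphic2_inf_ratio[of _ UNIV]]) (use Suc in auto)
  then have ratio: "holomorphic2_on (\<lambda>z. inf_ratio p B (?z z)) (inf_nhd \<alpha>)" by simp
  have "holomorphic2_on (\<lambda>z. A * fst (?z z) ^ n / inf_ratio p B (?z z)) (inf_nhd \<alpha>)" for n
    using Suc ratio
    by (intro holomorphic2_intros inf_ratio_nonzero[OF B] inf_orbit_in_nhd[OF AB]) auto
  then show ?case by (simp add: inf_step_def case_prod_unfold)
qed

text \<open>All ratios lie in the disc of radius \<open>r < 1\<close> about \<open>1\<close>, on which the logarithm is holomorphic and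
bounded. Hence the series is dominated by a geometric series and converges uniformly.\<close>

lemma holomorphic2_inf_factor:
  assumes AB: "norm A + norm B \<le> R + 1"
  shows "holomorphic2_on (inf_factor p A B) (inf_nhd \<alpha>)"
proof -
  have B: "norm B \<le> R + 1" using AB norm_ge_zero[of A] by linarith
  let ?z = "\<lambda>k z. (inf_step p A B ^^ k) z"
  let ?f = "\<lambda>k z. Ln (inf_ratio p B (?z k z)) / of_nat (degree p) ^ Suc k"
  have Re_pos: "Re w > 0" if "norm (w - 1) \<le> r" for w
    using that r abs_Re_le_cmod[of "w - 1"] by simp
  have hol_Ln: "Ln holomorphic_on {w. Re w > 0}"
    by (intro holomorphic_intros) (auto simp: complex_nonpos_Reals_iff)
  have "compact (Ln ` cball 1 r)"
    by (intro compact_continuous_image holomorphic_on_imp_continuous_on holomorphic_on_subset[OF hol_Ln])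
      (auto simp: dist_norm norm_minus_commute intro!: Re_pos)
  then obtain M where M: "\<And>w. w \<in> cball 1 r \<Longrightarrow> norm (Ln w) \<le> M"
    using compact_imp_bounded[of "Ln ` cball 1 r"] unfolding bounded_iff by blast
  have hol: "holomorphic2_on (?f k) (inf_nhd \<alpha>)" for k
  proof -
    have "holomorphic2_on (\<lambda>z. inf_ratio p B (fst (?z k z), snd (?z k z))) (inf_nhd \<alpha>)"
      by (rule holomorphic2_on_compose2[OF holomorphic2_inf_ratio[of _ UNIV]])
        (use holomorphic2_inf_orbit[OF AB] in auto)
    then have "holomorphic2_on (\<lambda>z. inf_ratio p B (?z k z)) (inf_nhd \<alpha>)" by simp
    then have "holomorphic2_on (\<lambda>z. Ln (inf_ratio p B (?z k z))) (inf_nhd \<alpha>)"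
    proof (rule holomorphic2_on_compose[OF hol_Ln open_halfspace_Re_gt])
      fix z assume "z \<in> inf_nhd \<alpha>"
      from inf_ratio_close_to_1[OF B inf_orbit_in_nhd[OF AB this]]
      show "inf_ratio p B (?z k z) \<in> {w. Re w > 0}" by (simp add: Re_pos less_imp_le)
    qed
    then show ?thesis using deg_pos by (intro holomorphic2_intros) auto
  qed
  have "uniform_limit (inf_nhd \<alpha>) (\<lambda>n z. \<Sum>k<n. ?f k z) (\<lambda>z. \<Sum>k. ?f k z) sequentially"
  proof (rule Weierstrass_m_test)
    show "summable (\<lambda>k. M / real (degree p) * (1 / real (degree p)) ^ k)"
      using deg by (intro summable_mult summable_geometric) auto
    fix k z assume z: "z \<in> inf_nhd \<alpha>"
    have "norm (Ln (inf_ratio p B (?z k z))) \<le> M"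
      using inf_ratio_close_to_1[OF B inf_orbit_in_nhd[OF AB z], of k]
      by (intro M) (simp add: dist_norm norm_minus_commute)
    then show "norm (?f k z) \<le> M / real (degree p) * (1 / real (degree p)) ^ k"
      using deg_pos by (simp add: norm_divide norm_mult norm_power power_divide divide_right_mono)
  qed
  then have "holomorphic2_on (\<lambda>z. \<Sum>k. ?f k z) (inf_nhd \<alpha>)"
    by (rule holomorphic2_on_uniform_limit[OF open_inf_nhd holomorphic2_on_sum[OF hol]])
  then have "holomorphic2_on (\<lambda>z. 0 - (\<Sum>k. ?f k z)) (inf_nhd \<alpha>)"
    by (intro holomorphic2_intros)
  from holomorphic2_on_compose[OF _ open_UNIV this, of exp]
  show ?thesis unfolding inf_factor_def by (simp add: holomorphic_on_exp)
qed

text \<open>On \<open>u = 0\<close> all ratios are \<open>1\<close>, so the factor minus \<open>1\<close> vanishes there and is divisible by \<open>u\<close>.\<close>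

lemma inf_factor_expansion:
  assumes "norm A + norm B \<le> R + 1"
  obtains g where "holomorphic2_on g (inf_nhd \<alpha>)"
    "\<And>u t. (u, t) \<in> inf_nhd \<alpha> \<Longrightarrow> inf_factor p A B (u, t) = 1 + u * g (u, t)"
proof -
  have "holomorphic2_on (\<lambda>z. inf_factor p A B z - 1) (inf_nhd \<alpha>)"
    by (intro holomorphic2_intros holomorphic2_inf_factor assms)
  then obtain g where "holomorphic2_on g (inf_nhd \<alpha>)"
    "\<And>u t. (u, t) \<in> inf_nhd \<alpha> \<Longrightarrow> inf_factor p A B (u, t) - 1 = u * g (u, t)"
    by (rule holomorphic2_on_divide_fst[OF open_inf_nhd]) (auto simp: inf_factor_0)
  then show ?thesis using that by (simp add: algebra_simps)
qed

text \<open>Away from \<open>u = 0\<close> the step is conjugate to the map on \<open>\<complex>\<^sup>2\<close>, and the ratio is the one that enters the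
definition of the Boettcher-type functions.\<close>

lemma inf_step_nz:
  assumes "A \<noteq> 0" "norm B \<le> R + 1" "(u, t) \<in> inf_nhd \<alpha>" "u \<noteq> 0" and s: "inf_step p A B (u, t) = (u', t')"
  shows "u' \<noteq> 0" "1 / u' = (poly p (1 / u) - B * (t / u)) / A" "t' / u' = 1 / u"
    "inf_ratio p B (u, t) = A * (1 / u') / (1 / u) ^ degree p"
proof -
  have nz: "inf_ratio p B (u, t) \<noteq> 0" by (rule inf_ratio_nonzero) fact+
  have u': "u' = A * u ^ degree p / inf_ratio p B (u, t)"
    and t': "t' = A * u ^ (degree p - 1) / inf_ratio p B (u, t)"
    using s by (auto simp: inf_step_def)
  show "u' \<noteq> 0" using u' nz assms by simp
  show "1 / u' = (poly p (1 / u) - B * (t / u)) / A"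
    unfolding u' inf_ratio_nz[OF assms(4)] using assms by simp
  have "u' = t' * u" unfolding u' t' by (subst deg_pos(3)) simp
  then show "t' / u' = 1 / u" using \<open>u' \<noteq> 0\<close> by auto
  show "inf_ratio p B (u, t) = A * (1 / u') / (1 / u) ^ degree p"
    unfolding u' using assms nz by (simp add: power_divide)
qed

text \<open>The coordinates \<open>x = 1/u\<close>, \<open>y = t/u\<close> carry the step over to the Henon map: its second component
is the old \<open>x\<close>, which matches \<open>t'/u' = 1/u\<close>.\<close>

lemma henon_orbit:
  assumes a: "norm a \<le> R" and z: "(u, t) \<in> inf_nhd \<alpha>" "u \<noteq> 0"
    and s: "(inf_step p 1 a ^^ k) (u, t) = (u', t')"
  shows "u' \<noteq> 0 \<and> (henon p a ^^ k) (1 / u, t / u) = (1 / u', t' / u')"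
  using s
proof (induction k arbitrary: u' t')
  case 0
  then show ?case using z by simp
next
  case (Suc k)
  obtain v w where vw: "(inf_step p 1 a ^^ k) (u, t) = (v, w)" by force
  have AB: "norm (1 :: complex) + norm a \<le> R + 1" "norm a \<le> R + 1" using a by auto
  have v: "v \<noteq> 0" "(henon p a ^^ k) (1 / u, t / u) = (1 / v, w / v)" using Suc.IH[OF vw] by auto
  have "(v, w) \<in> inf_nhd \<alpha>" using inf_orbit_in_nhd[OF AB(1) z(1), of k] vw by simp
  moreover have "inf_step p 1 a (v, w) = (u', t')" using Suc.prems vw by simp
  ultimately have "u' \<noteq> 0" "1 / u' = poly p (1 / v) - a * (w / v)" "t' / u' = 1 / v"
    using inf_step_nz[of 1 a v w u' t'] AB v by auto
  then show ?case using v by (simp add: henon_def)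
qed

lemma phi_plus_inv_eq:
  assumes a: "norm a \<le> R" and z: "(u, u * y) \<in> inf_nhd \<alpha>"
  shows "phi_plus_inv p a (u, y) = u * inf_factor p 1 a (u, u * y)"
proof (cases "u = 0")
  case True
  then show ?thesis by (simp add: phi_plus_inv_def)
next
  case False
  have "fwd_ratio p a (1 / u, y) (Suc k) = inf_ratio p a ((inf_step p 1 a ^^ k) (u, u * y))" for k
  proof -
    obtain v w where vw: "(inf_step p 1 a ^^ k) (u, u * y) = (v, w)" by force
    obtain v' w' where vw': "(inf_step p 1 a ^^ Suc k) (u, u * y) = (v', w')" by force
    have AB: "norm (1 :: complex) + norm a \<le> R + 1" "norm a \<le> R + 1" using a by auto
    note o = henon_orbit[OF a z False vw] henon_orbit[OF a z False vw']
    have "(v, w) \<in> inf_nhd \<alpha>" using inf_orbit_in_nhd[OF AB(1) z, of k] vw by simp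
    moreover have "inf_step p 1 a (v, w) = (v', w')" using vw vw' by simp
    ultimately have "inf_ratio p a (v, w) = 1 * (1 / v') / (1 / v) ^ degree p"
      using inf_step_nz(4)[of 1 a v w v' w'] AB o by auto
    then show ?thesis using o False by (simp add: fwd_ratio_def vw del: funpow.simps)
  qed
  then show ?thesis using False
    by (simp add: phi_plus_inv_def phi_plus_def inf_factor_def exp_minus field_simps)
qed

lemma henon_inv_orbit:
  assumes a: "norm a \<le> R" "a \<noteq> 0" and z: "(u, t) \<in> inf_nhd \<alpha>" "u \<noteq> 0"
    and s: "(inf_step p a 1 ^^ k) (u, t) = (u', t')"
  shows "u' \<noteq> 0 \<and> (henon_inv p a ^^ k) (t / u, 1 / u) = (t' / u', 1 / u')"
  using s
proof (induction k arbitrary: u' t')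
  case 0
  then show ?case using z by simp
next
  case (Suc k)
  obtain v w where vw: "(inf_step p a 1 ^^ k) (u, t) = (v, w)" by force
  have AB: "norm a + norm (1 :: complex) \<le> R + 1" "norm (1 :: complex) \<le> R + 1" using a R by auto
  have v: "v \<noteq> 0" "(henon_inv p a ^^ k) (t / u, 1 / u) = (w / v, 1 / v)" using Suc.IH[OF vw] by auto
  have "(v, w) \<in> inf_nhd \<alpha>" using inf_orbit_in_nhd[OF AB(1) z(1), of k] vw by simp
  moreover have "inf_step p a 1 (v, w) = (u', t')" using Suc.prems vw by simp
  ultimately have "u' \<noteq> 0" "1 / u' = (poly p (1 / v) - w / v) / a" "t' / u' = 1 / v"
    using inf_step_nz[of a 1 v w u' t'] AB v a by auto
  then show ?case using v by (simp add: henon_inv_def)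
qed

lemma phi_minus_eq:
  assumes a: "norm a \<le> R" "a \<noteq> 0" and z: "(v, v * x) \<in> inf_nhd \<alpha>" "v \<noteq> 0"
  shows "phi_minus p a (x, 1 / v) = 1 / (v * inf_factor p a 1 (v, v * x))"
proof -
  have "bwd_ratio_ext p a (x, 1 / v) (Suc k) = inf_ratio p 1 ((inf_step p a 1 ^^ k) (v, v * x))" for k
  proof -
    obtain s w where vw: "(inf_step p a 1 ^^ k) (v, v * x) = (s, w)" by force
    obtain s' w' where vw': "(inf_step p a 1 ^^ Suc k) (v, v * x) = (s', w')" by force
    have AB: "norm a + norm (1 :: complex) \<le> R + 1" "norm (1 :: complex) \<le> R + 1" using a R by auto
    note o = henon_inv_orbit[OF a z vw] henon_inv_orbit[OF a z vw']
    have "(s, w) \<in> inf_nhd \<alpha>" using inf_orbit_in_nhd[OF AB(1) z(1), of k] vw by simp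
    moreover have "inf_step p a 1 (s, w) = (s', w')" using vw vw' by simp
    ultimately have "inf_ratio p 1 (s, w) = a * (1 / s') / (1 / s) ^ degree p"
      using inf_step_nz(4)[of a 1 s w s' w'] AB o a by auto
    then show ?thesis using o a z by (simp add: bwd_ratio_ext_def bwd_ratio_def vw del: funpow.simps)
  qed
  then show ?thesis using z
    by (simp add: phi_minus_def inf_factor_def exp_minus field_simps)
qed

end

section \<open>The critical locus near the line at infinity\<close>

lemma order_1_derivs:
  fixes p :: "complex poly"
  assumes "order c (pderiv p) = 1" "degree p \<ge> 2"
  shows "poly (pderiv p) c = 0" "poly (pderiv (pderiv p)) c \<noteq> 0"
proof -
  have nz: "pderiv p \<noteq> 0" "pderiv (pderiv p) \<noteq> 0"
    using assms(2) by (auto simp: pderiv_eq_0_iff degree_pderiv)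
  show root: "poly (pderiv p) c = 0" using assms(1) by (simp add: order_root)
  have "order c (pderiv (pderiv p)) = 0" using order_pderiv[OF nz(1), of c] assms(1) root by simp
  then show "poly (pderiv (pderiv p)) c \<noteq> 0" using nz by (simp add: order_root)
qed

text \<open>The value of \<open>w_tilde\<close> on the line \<open>u = 0\<close> is a limit, which continuity of \<open>w\<close> identifies.\<close>

lemma w_tilde_eq:
  assumes S: "open S" and w: "holomorphic2_on w S"
    and form: "\<And>u y. (u, y) \<in> S \<Longrightarrow> form_coeff p a (u, y) = u\<^sup>2 * w (u, y)"
    and z: "z \<in> S"
  shows "w_tilde p a z = w z"
proof -
  obtain u y where uy: "z = (u, y)" by force
  show ?thesis
  proof (cases "u = 0")
    case False
    then show ?thesis using form z uy by (simp add: w_tilde_def)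
  next
    case True
    obtain \<rho> where \<rho>: "\<rho> > 0" "cball 0 \<rho> \<times> cball y \<rho> \<subseteq> S"
      using open_contains_polydisc[OF S] z uy True by metis
    have "isCont (\<lambda>v. w (v, y)) 0"
      using holomorphic2_on_slices(1)[OF w, of 0 y] z uy True
      by (simp add: field_differentiable_imp_continuous_at)
    then have "(\<lambda>v. w (v, y)) \<midarrow>0\<rightarrow> w (0, y)" by (simp add: isCont_def)
    moreover have "\<forall>\<^sub>F v in at 0. w (v, y) = form_coeff p a (v, y) / v\<^sup>2"
      unfolding eventually_at
      using \<rho> form by (intro exI[of _ \<rho>]) (auto simp: subset_iff)
    ultimately have "(\<lambda>v. form_coeff p a (v, y) / v\<^sup>2) \<midarrow>0\<rightarrow> w (0, y)"
      using tendsto_cong by (simp add: filterlim_cong)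
    then show ?thesis using uy True by (simp add: w_tilde_def tendsto_Lim)
  qed
qed

context escape
begin

text \<open>The reciprocal of the second coordinate \<open>(p(y) - x) / a\<close> of the preimage of \<open>(x, y)\<close>, with
\<open>x = 1/u\<close>. It is holomorphic also at \<open>u = 0\<close> and for \<open>a = 0\<close>, where it vanishes.\<close>

definition inv_y :: "complex \<Rightarrow> complex \<times> complex \<Rightarrow> complex" where
  "inv_y a = (\<lambda>(u, y). a * u / (u * poly p y - 1))"

text \<open>Both functions live where the point itself and its preimage, each read in the coordinates at
infinity, lie in the neighbourhood of infinity. This shows that the domain is open and absorbs the
case distinctions on \<open>u\<close> and \<open>a\<close>: for \<open>a = 0\<close> only \<open>u p(y) \<noteq> 1\<close> remains of the second condition.\<close>

lemma ext_domain_eq: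
  "ext_domain p \<alpha> a = {(u, y). (u, u * y) \<in> inf_nhd \<alpha> \<and> u * poly p y \<noteq> 1 \<and>
     (inv_y a (u, y), inv_y a (u, y) * y) \<in> inf_nhd \<alpha>}"
proof -
  have "(u, y) \<in> ext_domain p \<alpha> a \<longleftrightarrow> (u, u * y) \<in> inf_nhd \<alpha> \<and> u * poly p y \<noteq> 1 \<and>
     (inv_y a (u, y), inv_y a (u, y) * y) \<in> inf_nhd \<alpha>" for u y
  proof (cases "u = 0")
    case True
    then show ?thesis using \<alpha> by (simp add: ext_domain_def inf_nhd_def inv_y_def)
  next
    case u: False
    have nhd: "(v, v * y) \<in> inf_nhd \<alpha> \<longleftrightarrow> \<alpha> < norm (1 / v) \<and> norm y < norm (1 / v)" if "v \<noteq> 0" for v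
      using that \<alpha> by (simp add: inf_nhd_def norm_divide norm_mult field_simps)
    have Vp: "(1 / u, y) \<in> V_plus \<alpha> \<longleftrightarrow> (u, u * y) \<in> inf_nhd \<alpha>"
      unfolding nhd[OF u] by (auto simp: V_plus_def)
    show ?thesis
    proof (cases "a = 0")
      case True
      have "1 / u \<noteq> poly p y \<longleftrightarrow> u * poly p y \<noteq> 1" using u by (auto simp: field_simps)
      then show ?thesis using True u \<alpha> Vp by (auto simp: ext_domain_def inv_y_def inf_nhd_def)
    next
      case a: False
      have "(1 / u, y) \<in> henon p a ` V_minus \<alpha> \<longleftrightarrow> henon_inv p a (1 / u, y) \<in> V_minus \<alpha>"
        using henon_inverse[OF a, of p] by (metis (no_types, lifting) image_iff)
      also have "\<dots> \<longleftrightarrow> \<alpha> < norm ((poly p y - 1 / u) / a) \<and> norm y < norm ((poly p y - 1 / u) / a)"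
        by (auto simp: henon_inv_def V_minus_def)
      also have "\<dots> \<longleftrightarrow> u * poly p y \<noteq> 1 \<and> (inv_y a (u, y), inv_y a (u, y) * y) \<in> inf_nhd \<alpha>"
      proof (cases "u * poly p y = 1")
        case True
        then have "poly p y - 1 / u = 0" using u by (simp add: field_simps)
        then show ?thesis using \<alpha> True by simp
      next
        case False
        then have "inv_y a (u, y) \<noteq> 0" "(poly p y - 1 / u) / a = 1 / inv_y a (u, y)"
          using a u by (auto simp: inv_y_def field_simps)
        then show ?thesis using nhd False by simp
      qed
      finally show ?thesis using u a Vp by (simp add: ext_domain_def)
    qed
  qed
  then show ?thesis by auto
qed

lemma holomorphic2_inv_y:
  assumes "\<And>u y. (u, y) \<in> S \<Longrightarrow> u * poly p y \<noteq> 1"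
  shows "holomorphic2_on (inv_y a) S"
  unfolding inv_y_def case_prod_unfold using assms by (intro holomorphic2_intros) auto

lemma open_ext_domain: "open (ext_domain p \<alpha> a)"
proof -
  define S where "S = {z. fst z * poly p (snd z) \<noteq> 1}"
  have S: "open S" unfolding S_def by (intro open_Collect_neq continuous_intros)
  have "continuous_on S (inv_y a)"
    by (intro holomorphic2_on_imp_continuous_on holomorphic2_inv_y) (auto simp: S_def)
  then have "open (S \<inter> (\<lambda>z. (inv_y a z, inv_y a z * snd z)) -` inf_nhd \<alpha>)"
    by (intro continuous_open_preimage[OF _ S open_inf_nhd] continuous_intros)
  moreover have "open ((\<lambda>z. (fst z, fst z * snd z)) -` inf_nhd \<alpha> :: (complex \<times> complex) set)"
    by (intro open_inf_nhd open_vimage continuous_intros)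
  moreover have "ext_domain p \<alpha> a = (S \<inter> (\<lambda>z. (inv_y a z, inv_y a z * snd z)) -` inf_nhd \<alpha>) \<inter>
      ((\<lambda>z. (fst z, fst z * snd z)) -` inf_nhd \<alpha>)"
    by (auto simp: ext_domain_eq S_def)
  ultimately show ?thesis by auto
qed

text \<open>Dividing by \<open>a\<close> in the preimage and multiplying by \<open>a\<close> in the definition cancel, which is why the
formula covers \<open>a = 0\<close> as well; there the factor is \<open>1\<close>.\<close>

lemma phi_minus_inv_d_eq:
  assumes a: "norm a \<le> R" and z: "(u, y) \<in> ext_domain p \<alpha> a"
  shows "phi_minus_inv_d p a (u, y) =
     u / (u * poly p y - 1) * inf_factor p a 1 (inv_y a (u, y), inv_y a (u, y) * y)"
proof (cases "u = 0")
  case True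
  then show ?thesis by (simp add: phi_minus_inv_d_def)
next
  case u: False
  let ?v = "inv_y a (u, y)"
  have nz: "u * poly p y - 1 \<noteq> 0" and v: "(?v, ?v * y) \<in> inf_nhd \<alpha>"
    using z by (auto simp: ext_domain_eq)
  show ?thesis
  proof (cases "a = 0")
    case True
    then show ?thesis using u nz by (simp add: phi_minus_inv_d_def inv_y_def inf_factor_0 field_simps)
  next
    case False
    have "?v \<noteq> 0" and Y: "(poly p y - 1 / u) / a = 1 / ?v"
      using False u nz by (auto simp: inv_y_def field_simps)
    then have "phi_minus_inv_d p a (u, y) = ?v / a * inf_factor p a 1 (?v, ?v * y)"
      using u False phi_minus_eq[OF a False v]
      by (simp add: phi_minus_inv_d_def henon_inv_def)
    then show ?thesis using False by (simp add: inv_y_def)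
  qed
qed

text \<open>The second-order coefficients on the line \<open>u = 0\<close>. For \<open>\<phi>\<^sub>+\<close> the coefficient depends on \<open>y\<close> only
through \<open>t = u y\<close>, hence is constant on the line. For \<open>\<phi>\<^sub>-\<close> the only dependence on \<open>y\<close> comes from
\<open>1 / (u p(y) - 1) = - 1 - u p(y) - \<dots>\<close>, hence the coefficient is \<open>- p(y)\<close> plus a constant.\<close>

lemma extended_functions_expansion:
  assumes a: "norm a \<le> R"
  obtains E N where "holomorphic2_on E (ext_domain p \<alpha> a)" "holomorphic2_on N (ext_domain p \<alpha> a)"
    "\<And>u y. (u, y) \<in> ext_domain p \<alpha> a \<Longrightarrow> phi_plus_inv p a (u, y) = u + u\<^sup>2 * E (u, y)"
    "\<And>u y. (u, y) \<in> ext_domain p \<alpha> a \<Longrightarrow> phi_minus_inv_d p a (u, y) = - u + u\<^sup>2 * N (u, y)"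
    "\<And>y. E (0, y) = E (0, 0)" "\<And>y. N (0, y) = N (0, 0) + poly p 0 - poly p y"
proof -
  let ?D = "ext_domain p \<alpha> a"
  have AB: "norm (1 :: complex) + norm a \<le> R + 1" "norm a + norm (1 :: complex) \<le> R + 1"
    using a by auto
  obtain g where g: "holomorphic2_on g (inf_nhd \<alpha>)"
    "\<And>u t. (u, t) \<in> inf_nhd \<alpha> \<Longrightarrow> inf_factor p 1 a (u, t) = 1 + u * g (u, t)"
    using inf_factor_expansion[OF AB(1)] by blast
  obtain h where h: "holomorphic2_on h (inf_nhd \<alpha>)"
    "\<And>u t. (u, t) \<in> inf_nhd \<alpha> \<Longrightarrow> inf_factor p a 1 (u, t) = 1 + u * h (u, t)"
    using inf_factor_expansion[OF AB(2)] by blast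
  let ?m = "\<lambda>z. 1 / (fst z * poly p (snd z) - 1)"
  define E where "E = (\<lambda>z. g (fst z, fst z * snd z))"
  define N where "N = (\<lambda>z. poly p (snd z) * ?m z + a * (?m z)\<^sup>2 * h (inv_y a z, inv_y a z * snd z))"
  have D: "(u, u * y) \<in> inf_nhd \<alpha>" "u * poly p y \<noteq> 1" "(inv_y a (u, y), inv_y a (u, y) * y) \<in> inf_nhd \<alpha>"
    if "(u, y) \<in> ?D" for u y
    using that by (auto simp: ext_domain_eq)
  have holE: "holomorphic2_on E ?D"
    unfolding E_def by (rule holomorphic2_on_compose2[OF g(1)]) (intro holomorphic2_intros | use D in force)+
  have holv: "holomorphic2_on (inv_y a) ?D" using D(2) by (intro holomorphic2_inv_y) auto
  have "holomorphic2_on (\<lambda>z. h (inv_y a z, inv_y a z * snd z)) ?D"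
    by (rule holomorphic2_on_compose2[OF h(1) holv]) (intro holomorphic2_intros holv | use D in force)+
  moreover have "holomorphic2_on ?m ?D"
    using D(2) by (intro holomorphic2_intros) force
  ultimately have holN: "holomorphic2_on N ?D"
    unfolding N_def
    by (intro holomorphic2_on_add holomorphic2_on_mult holomorphic2_on_power holomorphic2_on_poly
        holomorphic2_on_const holomorphic2_on_snd)
  have F: "phi_plus_inv p a (u, y) = u + u\<^sup>2 * E (u, y)" if "(u, y) \<in> ?D" for u y
    using phi_plus_inv_eq[OF a D(1)[OF that]] g(2)[OF D(1)[OF that]]
    by (simp add: E_def power2_eq_square algebra_simps)
  have G: "phi_minus_inv_d p a (u, y) = - u + u\<^sup>2 * N (u, y)" if z: "(u, y) \<in> ?D" for u y
  proof -
    define m where "m = 1 / (u * poly p y - 1)"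
    \<comment> \<open>The beginning of the geometric series for \<open>m\<close>; it isolates the term \<open>- u\<close>.\<close>
    have m: "m = - 1 + u * poly p y * m" using D(2)[OF z] by (simp add: m_def field_simps)
    let ?h = "h (inv_y a (u, y), inv_y a (u, y) * y)"
    have v: "inv_y a (u, y) = a * u * m" by (simp add: inv_y_def m_def)
    have "phi_minus_inv_d p a (u, y) = u * m * (1 + a * u * m * ?h)"
      unfolding phi_minus_inv_d_eq[OF a z] h(2)[OF D(3)[OF z]] by (simp add: v m_def)
    also have "\<dots> = u * m + u\<^sup>2 * (a * m\<^sup>2 * ?h)" by (simp add: power2_eq_square algebra_simps)
    also have "u * m = - u + u\<^sup>2 * (poly p y * m)"
      by (subst m) (simp add: power2_eq_square algebra_simps)
    finally show ?thesis by (simp add: N_def m_def algebra_simps)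
  qed
  show ?thesis
    by (rule that[OF holE holN F G]) (auto simp: E_def N_def inv_y_def)
qed

text \<open>By the expansions, \<open>w_tilde\<close> restricts to \<open>- p'\<close> on the line \<open>u = 0\<close>. At a simple zero \<open>c\<close> of \<open>p'\<close>
its \<open>y\<close>-derivative is \<open>- p''(c) \<noteq> 0\<close>, while the differential of \<open>\<phi>\<^sub>+\<^sup>-\<^sup>1\<close> there is \<open>du\<close>. So the
two functions are local coordinates at \<open>(0, c)\<close>.\<close>

lemma critical_locus_at_infinity:
  assumes a: "norm a \<le> R" and c: "order c (pderiv p) = 1"
  shows "(0, c) \<in> critical_locus p \<alpha> a"
    and "smooth_zero_variety_at (ext_domain p \<alpha> a) (w_tilde p a) (0, c)"
    and "restr_local_biholomorphism_at (phi_plus_inv p a) (critical_locus p \<alpha> a) (0, c)"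
proof -
  let ?D = "ext_domain p \<alpha> a" and ?F = "phi_plus_inv p a" and ?G = "phi_minus_inv_d p a"
  have D: "open ?D" by (rule open_ext_domain)
  have D0: "(0, y) \<in> ?D" for y by (simp add: ext_domain_def)
  obtain E N where EN: "holomorphic2_on E ?D" "holomorphic2_on N ?D"
    "\<And>u y. (u, y) \<in> ?D \<Longrightarrow> ?F (u, y) = u + u\<^sup>2 * E (u, y)"
    "\<And>u y. (u, y) \<in> ?D \<Longrightarrow> ?G (u, y) = - u + u\<^sup>2 * N (u, y)"
    and at0: "\<And>y. E (0, y) = E (0, 0)" "\<And>y. N (0, y) = N (0, 0) + poly p 0 - poly p y"
    using extended_functions_expansion[OF a] by blast
  obtain w where w: "holomorphic2_on w ?D" "\<And>u y. (u, y) \<in> ?D \<Longrightarrow> jacobian ?F ?G (u, y) = u\<^sup>2 * w (u, y)"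
    "\<And>y. (0, y) \<in> ?D \<Longrightarrow> w (0, y) = deriv (\<lambda>t. E (0, t)) y + deriv (\<lambda>t. N (0, t)) y"
    and F: "holomorphic2_on ?F ?D" "\<And>y. (0, y) \<in> ?D \<Longrightarrow> deriv (\<lambda>v. ?F (v, y)) 0 = 1"
    using jacobian_factors[OF D EN] by blast
  have wt: "w_tilde p a z = w z" if "z \<in> ?D" for z
    by (rule w_tilde_eq[OF D w(1) _ that]) (use w(2) in \<open>simp add: jacobian_def form_coeff_def\<close>)
  have hol_w: "holomorphic2_on (w_tilde p a) ?D"
    by (rule holomorphic2_on_cong_open[OF D w(1)]) (simp add: wt)
  have w0: "w_tilde p a (0, y) = - poly (pderiv p) y" for y
  proof -
    have "deriv (\<lambda>t. E (0, t)) y = 0"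
      by (subst at0) simp
    moreover have "deriv (\<lambda>t. N (0, t)) y = - poly (pderiv p) y"
      by (subst at0) (auto intro!: DERIV_imp_deriv derivative_eq_intros)
    ultimately show ?thesis by (simp add: wt[OF D0] w(3)[OF D0])
  qed
  note c' = order_1_derivs[OF c deg]
  have zero: "w_tilde p a (0, c) = 0" using c' by (simp add: w0)
  have "deriv (\<lambda>t. w_tilde p a (0, t)) c = - poly (pderiv (pderiv p)) c"
    unfolding w0 by (auto intro!: DERIV_imp_deriv derivative_eq_intros)
  moreover have "deriv (\<lambda>t. ?F (0, t)) c = 0" by (simp add: phi_plus_inv_def)
  ultimately have J: "deriv (\<lambda>v. w_tilde p a (v, c)) 0 * deriv (\<lambda>t. ?F (0, t)) c
          \<noteq> deriv (\<lambda>t. w_tilde p a (0, t)) c * deriv (\<lambda>v. ?F (v, c)) 0"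
    using c' F(2)[OF D0] by simp
  show "(0, c) \<in> critical_locus p \<alpha> a"
    using D0 zero by (simp add: critical_locus_def zero_variety_def)
  show "smooth_zero_variety_at ?D (w_tilde p a) (0, c)"
    by (rule restriction_coordinates(1)[OF D hol_w F(1) D0 zero J])
  show "restr_local_biholomorphism_at ?F (critical_locus p \<alpha> a) (0, c)"
    unfolding critical_locus_def by (rule restriction_coordinates(2)[OF D hol_w F(1) D0 zero J])
qed

end

theorem theorem2p13:
  fixes p q :: "complex poly" and d :: nat and R r \<alpha> :: real and a c :: complex
  assumes d: "d \<ge> 2" and q: "degree q < d" and p: "p = monom 1 d + q"
    and R: "R > 0" and r: "0 < r" "r < 1" and \<alpha>: "\<alpha> > 0"
    and q_bound: "\<And>y. norm y \<ge> \<alpha> \<Longrightarrow>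
          norm (poly q y / y ^ d) + (R + 1) / norm y ^ (d - 1) < r"
    and p_bound: "\<And>y. norm y \<ge> \<alpha> \<Longrightarrow> norm (poly p y) > (2 * R + 1) * norm y"
    and a: "a \<in> ball 0 R"
    and c: "order c (pderiv p) = 1"
  shows "(0, c) \<in> critical_locus p \<alpha> a \<and>
         smooth_zero_variety_at (ext_domain p \<alpha> a) (w_tilde p a) (0, c) \<and>
         restr_local_biholomorphism_at (phi_plus_inv p a) (critical_locus p \<alpha> a) (0, c)"
proof -
  have deg: "degree p = d" using q by (simp add: p degree_add_eq_left degree_monom_eq)
  have "coeff q d = 0" using q by (rule coeff_eq_0)
  then have lead: "lead_coeff p = 1" unfolding deg by (simp add: p)
  interpret escape p R r \<alpha>
  proof
    fix x :: complex assume x: "norm x \<ge> \<alpha>"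
    then have "x \<noteq> 0" using \<alpha> by auto
    then have "poly p x / x ^ degree p - 1 = poly q x / x ^ d"
      unfolding deg by (simp add: p poly_monom field_simps)
    then show "norm (poly p x / x ^ degree p - 1) + (R + 1) / norm x ^ (degree p - 1) < r"
      using q_bound[OF x] by (simp only: deg)
  qed (use d R r \<alpha> p_bound lead deg in auto)
  show ?thesis
    using critical_locus_at_infinity[OF _ c] a by simp
qed

end
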